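(* Let $\kappa$ be an inaccessible cardinal, let ${}^*\mathbb{Q}$ be a saturated model of $\operatorname{Th}(\mathbb{Q})$ (in the ring language) of cardinality $\kappa$, and let ${}^*\mathbb{Z}$ be the nonstandard integer ring of ${}^*\mathbb{Q}$. Then every abelian group $(A,+_A,1_A)$ definable (with parameters) in ${}^*\mathbb{Q}$ admits a ${}^*\mathbb{Z}$-module structure $\cdot^*:{}^*\mathbb{Z}\times A\to A$ extending its natural $\mathbb{Z}$-module structure, i.e. $n\cdot^*a=n\cdot a$ for all $n\in\mathbb{Z}$, $a\in A$. In particular, for every nonsingular elliptic curve $E$ over ${}^*\mathbb{Q}$, $E({}^*\mathbb{Q})$ has such a ${}^*\mathbb{Z}$-module structure.
   Context: ${}^*\mathbb{Z}=Z({}^*\mathbb{Q})$ for a fixed ring-language formula $Z(x)$ defining $\mathbb{Z}$ in $\mathbb{Q}$; $\mathbb{Z}\subseteq{}^*\mathbb{Z}$ via the elementary embedding. The natural $\mathbb{Z}$-module structure on an abelian group $A$ is $n\cdot a=a+_A\cdots+_Aa$ ($n$ times) for $n>0$, $0\cdot a=1_A$ (the identity), and $n\cdot a=(-a)+_A\cdots+_A(-a)$ ($|n|$ times) for $n<0$. A nonsingular elliptic curve over a field $L$ is $y^2=x^3+Ax+B$, $A,B\in L$, $4A^3+27B^2\ne0$, and $E(L)$ (its points with the point at infinity) is a definable abelian group. *)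

theory Defs
  imports Complex_Main "HOL-Algebra.Group"
begin

datatype rtm = TV nat | TZero | TOne | TAdd rtm rtm | TNeg rtm | TMul rtm rtm

datatype rfm = FEq rtm rtm | FNot rfm | FConj rfm rfm | FEx nat rfm

fun evt :: "(nat \<Rightarrow> 'a::comm_ring_1) \<Rightarrow> rtm \<Rightarrow> 'a" where
  "evt e (TV i) = e i"
| "evt e TZero = 0"
| "evt e TOne = 1"
| "evt e (TAdd s t) = evt e s + evt e t"
| "evt e (TNeg s) = - evt e s"
| "evt e (TMul s t) = evt e s * evt e t"

fun rsat :: "(nat \<Rightarrow> 'a::comm_ring_1) \<Rightarrow> rfm \<Rightarrow> bool" where
  "rsat e (FEq s t) = (evt e s = evt e t)"
| "rsat e (FNot p) = (\<not> rsat e p)"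
| "rsat e (FConj p q) = (rsat e p \<and> rsat e q)"
| "rsat e (FEx x p) = (\<exists>a. rsat (e(x := a)) p)"

fun fvt :: "rtm \<Rightarrow> nat set" where
  "fvt (TV i) = {i}"
| "fvt TZero = {}"
| "fvt TOne = {}"
| "fvt (TAdd s t) = fvt s \<union> fvt t"
| "fvt (TNeg s) = fvt s"
| "fvt (TMul s t) = fvt s \<union> fvt t"

fun fvf :: "rfm \<Rightarrow> nat set" where
  "fvf (FEq s t) = fvt s \<union> fvt t"
| "fvf (FNot p) = fvf p"
| "fvf (FConj p q) = fvf p \<union> fvf q"
| "fvf (FEx x p) = fvf p - {x}"

definition ThQ_model :: "'a::comm_ring_1 itself \<Rightarrow> bool" where
  "ThQ_model T \<longleftrightarrow>
     (\<forall>\<phi>. fvf \<phi> = {} \<longrightarrow> (rsat (\<lambda>_. 0::rat) \<phi> \<longleftrightarrow> rsat (\<lambda>_. 0::'a) \<phi>))"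

text \<open>A partial 1-type with parameters: a set of pairs (formula, assignment);
variable 0 is the free variable, the other free variables are parameters.\<close>
definition type_params :: "(rfm \<times> (nat \<Rightarrow> 'a)) set \<Rightarrow> 'a set" where
  "type_params \<Phi> = (\<Union>(\<phi>, e)\<in>\<Phi>. e ` (fvf \<phi> - {0}))"

definition realized :: "(rfm \<times> (nat \<Rightarrow> 'a::comm_ring_1)) set \<Rightarrow> bool" where
  "realized \<Phi> \<longleftrightarrow> (\<exists>a. \<forall>(\<phi>, e)\<in>\<Phi>. rsat (e(0 := a)) \<phi>)"

definition saturated :: "'a::comm_ring_1 itself \<Rightarrow> bool" where
  "saturated T \<longleftrightarrow>
     (\<forall>\<Phi> :: (rfm \<times> (nat \<Rightarrow> 'a)) set.
        (card_of (type_params \<Phi>), card_of (UNIV :: 'a set)) \<in> ordLess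
        \<and> (\<forall>\<Psi>\<subseteq>\<Phi>. finite \<Psi> \<longrightarrow> realized \<Psi>)
        \<longrightarrow> realized \<Phi>)"

definition inaccessible :: "'a set \<Rightarrow> bool" where
  "inaccessible U \<longleftrightarrow>
     (card_of (UNIV :: nat set), card_of U) \<in> ordLess
     \<and> (\<forall>B\<subseteq>U. (card_of B, card_of U) \<in> ordLess \<longrightarrow> (card_of (Pow B), card_of U) \<in> ordLess)
     \<and> (\<forall>I\<subseteq>U. \<forall>F. (card_of I, card_of U) \<in> ordLess
            \<and> (\<forall>i\<in>I. F i \<subseteq> U \<and> (card_of (F i), card_of U) \<in> ordLess)
            \<longrightarrow> (card_of (\<Union>i\<in>I. F i), card_of U) \<in> ordLess)"

text \<open>Z(*Q) for a formula Z(x) defining Z in Q (all such formulas define the same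
set in any model of Th(Q)).\<close>
definition starZ :: "'a::comm_ring_1 itself \<Rightarrow> 'a set" where
  "starZ T = {a. \<exists>\<phi>. fvf \<phi> \<subseteq> {0} \<and> (\<forall>q::rat. rsat (\<lambda>_. q) \<phi> \<longleftrightarrow> q \<in> \<int>)
                      \<and> rsat (\<lambda>_. a) \<phi>}"

definition env :: "'a list \<Rightarrow> (nat \<Rightarrow> 'a) \<Rightarrow> nat \<Rightarrow> 'a" where
  "env xs e = (\<lambda>i. if i < length xs then xs ! i else e i)"

definition definable :: "nat \<Rightarrow> 'a::comm_ring_1 list set \<Rightarrow> bool" where
  "definable n S \<longleftrightarrow> (\<exists>\<phi> e. S = {xs. length xs = n \<and> rsat (env xs e) \<phi>})"

definition definable_group ::
    "nat \<Rightarrow> 'a::comm_ring_1 list set \<Rightarrow> ('a list \<Rightarrow> 'a list \<Rightarrow> 'a list) \<Rightarrow> 'a list \<Rightarrow> bool" where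
  "definable_group n A f u \<longleftrightarrow>
     A \<subseteq> {xs. length xs = n} \<and> definable n A
     \<and> definable (3 * n) {xs @ ys @ f xs ys | xs ys. xs \<in> A \<and> ys \<in> A}
     \<and> comm_group \<lparr>carrier = A, mult = f, one = u\<rparr>"

definition starZ_module_ext ::
    "('b, 'c) monoid_scheme \<Rightarrow> 'a::comm_ring_1 set \<Rightarrow> ('a \<Rightarrow> 'b \<Rightarrow> 'b) \<Rightarrow> bool" where
  "starZ_module_ext G Zs sm \<longleftrightarrow>
     (\<forall>r\<in>Zs. \<forall>a\<in>carrier G. sm r a \<in> carrier G)
     \<and> (\<forall>r\<in>Zs. \<forall>s\<in>Zs. \<forall>a\<in>carrier G. sm (r + s) a = sm r a \<otimes>\<^bsub>G\<^esub> sm s a)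
     \<and> (\<forall>r\<in>Zs. \<forall>a\<in>carrier G. \<forall>b\<in>carrier G. sm r (a \<otimes>\<^bsub>G\<^esub> b) = sm r a \<otimes>\<^bsub>G\<^esub> sm r b)
     \<and> (\<forall>r\<in>Zs. \<forall>s\<in>Zs. \<forall>a\<in>carrier G. sm (r * s) a = sm r (sm s a))
     \<and> (\<forall>a\<in>carrier G. sm 1 a = a)
     \<and> (\<forall>n::int. \<forall>a\<in>carrier G. sm (of_int n) a = a [^]\<^bsub>G\<^esub> n)"

definition ec_points :: "'a::field \<Rightarrow> 'a \<Rightarrow> ('a \<times> 'a) option set" where
  "ec_points a b = insert None {Some (x, y) | x y. y ^ 2 = x ^ 3 + a * x + b}"

fun ec_add :: "'a::field \<Rightarrow> ('a \<times> 'a) option \<Rightarrow> ('a \<times> 'a) option \<Rightarrow> ('a \<times> 'a) option" where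
  "ec_add a None q = q"
| "ec_add a (Some p) None = Some p"
| "ec_add a (Some (x1, y1)) (Some (x2, y2)) =
     (if x1 = x2 \<and> y1 = - y2 then None
      else let l = (if x1 = x2 then (3 * x1 ^ 2 + a) / (2 * y1) else (y2 - y1) / (x2 - x1));
               x3 = l ^ 2 - x1 - x2;
               y3 = l * (x1 - x3) - y1
           in Some (x3, y3))"

definition ec_group :: "'a::field \<Rightarrow> 'a \<Rightarrow> ('a \<times> 'a) option monoid" where
  "ec_group a b = \<lparr>carrier = ec_points a b, mult = ec_add a, one = None\<rparr>"

end

theory Submission
  imports Defs
begin

text \<open>
  Over the rationals, the integer multiples of an element of a group given by formulas are themselves
  given by a formula, uniformly in the parameters: \<open>y = k \<cdot> x\<close> holds iff \<open>(k, y)\<close> lies in every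
  finite set that contains \<open>(0, 1)\<close> and, along with each \<open>(i, z)\<close>, \<open>i \<noteq> k\<close>, also \<open>(i + 1, z + x)\<close>, and
  the same for steps by \<open>-1\<close>; for the wrong sign of the step there is no such finite set.
  Finite sets of rational tuples are coded by a variant of the beta function. The statement that this
  formula defines a module structure over \<open>Z\<close> is then a scheme of first-order sentences true in the
  rationals, hence true in every model of their theory. If no formula defines \<open>Z\<close>, then \<^term>\<open>starZ T\<close>
  is empty, so definability of the integers is not needed.

  Elliptic curves become definable groups by coding points as triples. Associativity of the chord and
  tangent law: the product of the line through \<open>P, Q\<close> and the line through \<open>P + Q, R\<close>, divided by the
  vertical line through \<open>P + Q\<close>, is a function \<open>x\<^sup>2 + A y + B x + C\<close> on the curve that vanishes at
  \<open>P, Q, R\<close>. Such a function is unique, so it is the same for the other bracketing, and its fourth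
  zero is the negative of the sum.
\<close>

section \<open>Definability and transfer\<close>

fun subt :: "(nat \<Rightarrow> rtm) \<Rightarrow> rtm \<Rightarrow> rtm" where
  "subt \<sigma> (TV i) = \<sigma> i"
| "subt \<sigma> TZero = TZero"
| "subt \<sigma> TOne = TOne"
| "subt \<sigma> (TAdd s t) = TAdd (subt \<sigma> s) (subt \<sigma> t)"
| "subt \<sigma> (TNeg s) = TNeg (subt \<sigma> s)"
| "subt \<sigma> (TMul s t) = TMul (subt \<sigma> s) (subt \<sigma> t)"

text \<open>The bound variable is renamed to one that occurs in no term substituted for a free
  variable of the body, so nothing is captured. Finiteness of these variable sets makes the choice
  possible.\<close>

fun subf :: "(nat \<Rightarrow> rtm) \<Rightarrow> rfm \<Rightarrow> rfm" where
  "subf \<sigma> (FEq s t) = FEq (subt \<sigma> s) (subt \<sigma> t)"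
| "subf \<sigma> (FNot p) = FNot (subf \<sigma> p)"
| "subf \<sigma> (FConj p q) = FConj (subf \<sigma> p) (subf \<sigma> q)"
| "subf \<sigma> (FEx x p) =
     (let y = (SOME y. y \<notin> (\<Union>i\<in>fvf p. fvt (\<sigma> i))) in FEx y (subf (\<sigma>(x := TV y)) p))"

lemma finite_fvt [simp]: "finite (fvt t)"
  by (induction t) auto

lemma finite_fvf [simp]: "finite (fvf p)"
  by (induction p) auto

lemma evt_cong: "(\<And>i. i \<in> fvt t \<Longrightarrow> e i = e' i) \<Longrightarrow> evt e t = evt e' t"
  by (induction t) auto

lemma rsat_cong: "(\<And>i. i \<in> fvf p \<Longrightarrow> e i = e' i) \<Longrightarrow> rsat e p = rsat e' p"
proof (induction p arbitrary: e e')
  case (FEq s t)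
  have "evt e s = evt e' s" "evt e t = evt e' t"
    by (rule evt_cong, simp add: FEq)+
  then show ?case by simp
next
  case (FNot p)
  have "rsat e p = rsat e' p" by (rule FNot.IH) (simp add: FNot.prems)
  then show ?case by simp
next
  case (FConj p q)
  have "rsat e p = rsat e' p" by (rule FConj.IH) (simp add: FConj.prems)
  moreover have "rsat e q = rsat e' q" by (rule FConj.IH) (simp add: FConj.prems)
  ultimately show ?case by simp
next
  case (FEx x p)
  have "rsat (e(x := a)) p = rsat (e'(x := a)) p" for a
    by (rule FEx.IH) (simp add: FEx.prems)
  then show ?case by simp
qed

lemma evt_subt: "evt e (subt \<sigma> t) = evt (\<lambda>i. evt e (\<sigma> i)) t"
  by (induction t) auto

lemma rsat_subf: "rsat e (subf \<sigma> p) = rsat (\<lambda>i. evt e (\<sigma> i)) p"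
proof (induction p arbitrary: e \<sigma>)
  case (FEx x p)
  define y where "y = (SOME y. y \<notin> (\<Union>i\<in>fvf p. fvt (\<sigma> i)))"
  have "\<exists>y. y \<notin> (\<Union>i\<in>fvf p. fvt (\<sigma> i))"
    by (rule ex_new_if_finite) auto
  then have y: "y \<notin> (\<Union>i\<in>fvf p. fvt (\<sigma> i))"
    unfolding y_def by (rule someI_ex)
  \<comment> \<open>By induction for the altered substitution; freshness of \<open>y\<close> makes
    both assignments agree on the free variables of \<open>p\<close>.\<close>
  have "rsat (e(y := a)) (subf (\<sigma>(x := TV y)) p) = rsat ((\<lambda>i. evt e (\<sigma> i))(x := a)) p" for a
    unfolding FEx.IH
  proof (rule rsat_cong)
    fix i assume "i \<in> fvf p"
    then show "evt (e(y := a)) ((\<sigma>(x := TV y)) i) = ((\<lambda>i. evt e (\<sigma> i))(x := a)) i"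
      using y by (auto intro!: evt_cong)
  qed
  then show ?case by (simp only: subf.simps Let_def y_def[symmetric] rsat.simps)
qed (auto simp: evt_subt)

section \<open>Predicates defined by one formula over two rings\<close>

text \<open>Replaces writing formulas by hand: the rules collected in \<open>codef_intros\<close>
  build the common formula along the HOL text of \<open>P\<close> and \<open>Q\<close>. With both
  rings equal this is plain definability.\<close>

definition codef :: "((nat \<Rightarrow> 'a::comm_ring_1) \<Rightarrow> bool) \<Rightarrow> ((nat \<Rightarrow> 'b::comm_ring_1) \<Rightarrow> bool) \<Rightarrow> bool" where
  "codef P Q \<longleftrightarrow> (\<exists>\<phi>. (\<forall>e. rsat e \<phi> = P e) \<and> (\<forall>e. rsat e \<phi> = Q e))"

definition cterm :: "((nat \<Rightarrow> 'a::comm_ring_1) \<Rightarrow> 'a) \<Rightarrow> ((nat \<Rightarrow> 'b::comm_ring_1) \<Rightarrow> 'b) \<Rightarrow> bool" where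
  "cterm s s' \<longleftrightarrow> (\<exists>t. (\<forall>e. evt e t = s e) \<and> (\<forall>e. evt e t = s' e))"

text \<open>The length is a fixed number, so a tuple of variables can be represented by finitely
  many terms, and equality of tuples by a finite conjunction.\<close>

definition clist :: "nat \<Rightarrow> ((nat \<Rightarrow> 'a::comm_ring_1) \<Rightarrow> 'a list) \<Rightarrow> ((nat \<Rightarrow> 'b::comm_ring_1) \<Rightarrow> 'b list) \<Rightarrow> bool" where
  "clist n l l' \<longleftrightarrow> (\<exists>ts. length ts = n \<and> (\<forall>e. map (evt e) ts = l e) \<and> (\<forall>e. map (evt e) ts = l' e))"

lemma codefI: "(\<And>e. rsat e \<phi> = P e) \<Longrightarrow> (\<And>e. rsat e \<phi> = Q e) \<Longrightarrow> codef P Q"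
  unfolding codef_def by blast

lemma ctermI: "(\<And>e. evt e t = s e) \<Longrightarrow> (\<And>e. evt e t = s' e) \<Longrightarrow> cterm s s'"
  unfolding cterm_def by blast

lemma clistI: "length ts = n \<Longrightarrow> (\<And>e. map (evt e) ts = s e) \<Longrightarrow> (\<And>e. map (evt e) ts = s' e) \<Longrightarrow> clist n s s'"
  unfolding clist_def by blast

lemma codefE:
  assumes "codef P Q"
  obtains \<phi> where "\<And>e. rsat e \<phi> = P e" "\<And>e. rsat e \<phi> = Q e"
  using assms unfolding codef_def by blast

lemma clistE:
  assumes "clist n l l'"
  obtains ts where "length ts = n" "l = (\<lambda>e. map (evt e) ts)" "l' = (\<lambda>e. map (evt e) ts)"
proof -
  from assms obtain ts where "length ts = n" "\<forall>e. map (evt e) ts = l e" "\<forall>e. map (evt e) ts = l' e"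
    unfolding clist_def by blast
  then show ?thesis by (intro that[of ts]) auto
qed

lemma cterm_evt: "cterm (\<lambda>e. evt e t) (\<lambda>e. evt e t)"
  by (rule ctermI) auto

named_theorems codef_intros

lemma cterm_var [codef_intros]: "cterm (\<lambda>e. e i) (\<lambda>e. e i)"
  by (rule ctermI[of "TV i"]) auto

lemma cterm_zero [codef_intros]: "cterm (\<lambda>e. 0) (\<lambda>e. 0)"
  by (rule ctermI[of TZero]) auto

lemma cterm_one [codef_intros]: "cterm (\<lambda>e. 1) (\<lambda>e. 1)"
  by (rule ctermI[of TOne]) auto

lemma cterm_add [codef_intros]:
  assumes "cterm s s'" "cterm t t'"
  shows "cterm (\<lambda>e. s e + t e) (\<lambda>e. s' e + t' e)"
proof -
  from assms obtain a b where "\<forall>e. evt e a = s e" "\<forall>e. evt e a = s' e"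
      "\<forall>e. evt e b = t e" "\<forall>e. evt e b = t' e"
    unfolding cterm_def by blast
  then show ?thesis by (intro ctermI[of "TAdd a b"]) simp_all
qed

lemma cterm_mult [codef_intros]:
  assumes "cterm s s'" "cterm t t'"
  shows "cterm (\<lambda>e. s e * t e) (\<lambda>e. s' e * t' e)"
proof -
  from assms obtain a b where "\<forall>e. evt e a = s e" "\<forall>e. evt e a = s' e"
      "\<forall>e. evt e b = t e" "\<forall>e. evt e b = t' e"
    unfolding cterm_def by blast
  then show ?thesis by (intro ctermI[of "TMul a b"]) simp_all
qed

lemma cterm_uminus [codef_intros]:
  assumes "cterm s s'"
  shows "cterm (\<lambda>e. - s e) (\<lambda>e. - s' e)"
proof -
  from assms obtain a where "\<forall>e. evt e a = s e" "\<forall>e. evt e a = s' e"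
    unfolding cterm_def by blast
  then show ?thesis by (intro ctermI[of "TNeg a"]) simp_all
qed

lemma cterm_diff [codef_intros]:
  assumes "cterm s s'" "cterm t t'"
  shows "cterm (\<lambda>e. s e - t e) (\<lambda>e. s' e - t' e)"
  using cterm_add[OF assms(1) cterm_uminus[OF assms(2)]] by simp

lemma cterm_power [codef_intros]:
  assumes "cterm s s'"
  shows "cterm (\<lambda>e. s e ^ k) (\<lambda>e. s' e ^ k)"
  by (induction k) (simp_all add: cterm_one cterm_mult assms)

lemma cterm_of_nat [codef_intros]: "cterm (\<lambda>e. of_nat k) (\<lambda>e. of_nat k)"
  by (induction k) (simp_all add: cterm_zero cterm_one cterm_add)

lemma cterm_numeral [codef_intros]: "cterm (\<lambda>e. numeral k) (\<lambda>e. numeral k)"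
  using cterm_of_nat[of "numeral k"] by simp

lemma codef_eq [codef_intros]:
  assumes "cterm s s'" "cterm t t'"
  shows "codef (\<lambda>e. s e = t e) (\<lambda>e. s' e = t' e)"
proof -
  from assms obtain a b where "\<forall>e. evt e a = s e" "\<forall>e. evt e a = s' e"
      "\<forall>e. evt e b = t e" "\<forall>e. evt e b = t' e"
    unfolding cterm_def by blast
  then show ?thesis by (intro codefI[of "FEq a b"]) simp_all
qed

lemma codef_not [codef_intros]:
  assumes "codef P Q"
  shows "codef (\<lambda>e. \<not> P e) (\<lambda>e. \<not> Q e)"
proof -
  from assms obtain p where "\<forall>e. rsat e p = P e" "\<forall>e. rsat e p = Q e"
    unfolding codef_def by blast
  then show ?thesis by (intro codefI[of "FNot p"]) simp_all
qed

lemma codef_conj [codef_intros]: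
  assumes "codef P Q" "codef P' Q'"
  shows "codef (\<lambda>e. P e \<and> P' e) (\<lambda>e. Q e \<and> Q' e)"
proof -
  from assms obtain p q where "\<forall>e. rsat e p = P e" "\<forall>e. rsat e p = Q e"
      "\<forall>e. rsat e q = P' e" "\<forall>e. rsat e q = Q' e"
    unfolding codef_def by blast
  then show ?thesis by (intro codefI[of "FConj p q"]) simp_all
qed

lemma codef_imp [codef_intros]:
  assumes "codef P Q" "codef P' Q'"
  shows "codef (\<lambda>e. P e \<longrightarrow> P' e) (\<lambda>e. Q e \<longrightarrow> Q' e)"
  using codef_not[OF codef_conj[OF assms(1) codef_not[OF assms(2)]]] by simp

lemma codef_disj [codef_intros]:
  assumes "codef P Q" "codef P' Q'"
  shows "codef (\<lambda>e. P e \<or> P' e) (\<lambda>e. Q e \<or> Q' e)"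
  using codef_imp[OF codef_not[OF assms(1)] assms(2)] by (simp add: disj_imp)

lemma codef_True: "codef (\<lambda>e. True) (\<lambda>e. True)"
  using codef_eq[OF cterm_zero cterm_zero] by simp

lemma codef_iff [codef_intros]:
  assumes "codef P Q" "codef P' Q'"
  shows "codef (\<lambda>e. P e \<longleftrightarrow> P' e) (\<lambda>e. Q e \<longleftrightarrow> Q' e)"
  using codef_conj[OF codef_imp[OF assms] codef_imp[OF assms(2,1)]] by (simp add: iff_conv_conj_imp)

text \<open>Undoes a de Bruijn shift: variable \<open>0\<close> becomes the named variable
  \<open>m\<close> and \<open>Suc i\<close> becomes \<open>i\<close>. No clash arises as long as
  \<open>m\<close> is not the image of a free variable \<open>Suc m\<close>.\<close>

lemma rsat_subf_fresh:
  assumes "Suc m \<notin> fvf \<phi>"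
  shows "rsat (e(m := a)) (subf (case_nat (TV m) TV) \<phi>) = rsat (case_nat a e) \<phi>"
  unfolding rsat_subf by (rule rsat_cong) (use assms in \<open>simp split: nat.split, metis\<close>)

text \<open>In the premise the quantified value sits at index \<open>0\<close> and all other
  variables are moved up by one, so nested quantifiers need no names.\<close>

lemma codef_ex [codef_intros]:
  assumes "codef (\<lambda>e. P (e 0) (\<lambda>i. e (Suc i))) (\<lambda>e. Q (e 0) (\<lambda>i. e (Suc i)))"
  shows "codef (\<lambda>e. \<exists>x. P x e) (\<lambda>e. \<exists>x. Q x e)"
  using assms
proof (rule codefE)
  fix \<phi> assume \<phi>: "\<And>e. rsat e \<phi> = P (e 0) (\<lambda>i. e (Suc i))"
    "\<And>e. rsat e \<phi> = Q (e 0) (\<lambda>i. e (Suc i))"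
  obtain m where m: "Suc m \<notin> fvf \<phi>"
    using ex_new_if_finite[OF infinite_UNIV_nat finite_vimageI[OF finite_fvf inj_Suc]]
    unfolding vimage_def mem_Collect_eq by blast
  show ?thesis
  proof (rule codefI[of "FEx m (subf (case_nat (TV m) TV) \<phi>)"])
    show "rsat e (FEx m (subf (case_nat (TV m) TV) \<phi>)) = (\<exists>x. P x e)" for e
      by (simp only: rsat.simps rsat_subf_fresh[OF m]) (simp add: \<phi>(1))
    show "rsat e (FEx m (subf (case_nat (TV m) TV) \<phi>)) = (\<exists>x. Q x e)" for e
      by (simp only: rsat.simps rsat_subf_fresh[OF m]) (simp add: \<phi>(2))
  qed
qed

lemma codef_all [codef_intros]:
  assumes "codef (\<lambda>e. P (e 0) (\<lambda>i. e (Suc i))) (\<lambda>e. Q (e 0) (\<lambda>i. e (Suc i)))"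
  shows "codef (\<lambda>e. \<forall>x. P x e) (\<lambda>e. \<forall>x. Q x e)"
  using codef_not[OF codef_ex[of "\<lambda>x e. \<not> P x e" "\<lambda>x e. \<not> Q x e", OF codef_not[OF assms]]] by simp

lemma clist_cons [codef_intros]:
  assumes "cterm s s'" "clist n l l'"
  shows "clist (Suc n) (\<lambda>e. s e # l e) (\<lambda>e. s' e # l' e)"
proof -
  from assms obtain t ts where "\<forall>e. evt e t = s e" "\<forall>e. evt e t = s' e"
      "length ts = n" "\<forall>e. map (evt e) ts = l e" "\<forall>e. map (evt e) ts = l' e"
    unfolding cterm_def clist_def by blast
  then show ?thesis by (intro clistI[of "t # ts"]) simp_all
qed

lemma clist_append [codef_intros]:
  assumes "clist n k k'" "clist m l l'"
  shows "clist (n + m) (\<lambda>e. k e @ l e) (\<lambda>e. k' e @ l' e)"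
proof -
  from assms obtain ts us where
      "length ts = n" "\<forall>e. map (evt e) ts = k e" "\<forall>e. map (evt e) ts = k' e"
      "length us = m" "\<forall>e. map (evt e) us = l e" "\<forall>e. map (evt e) us = l' e"
    unfolding clist_def by blast
  then show ?thesis by (intro clistI[of "ts @ us"]) simp_all
qed

lemma clist_map [codef_intros]: "clist n (\<lambda>e. map (\<lambda>i. e (\<tau> i)) [0..<n]) (\<lambda>e. map (\<lambda>i. e (\<tau> i)) [0..<n])"
  by (rule clistI[of "map (\<lambda>i. TV (\<tau> i)) [0..<n]"]) auto

lemma ex_list_Suc: "(\<exists>x. length x = Suc n \<and> R x) = (\<exists>xs. length xs = n \<and> (\<exists>x. R (x # xs)))"
  by (metis length_Suc_conv length_Cons)

lemma map_upt_shift: "map (\<lambda>i. e i) [0..<Suc n] = e 0 # map (\<lambda>i. e (Suc i)) [0..<n]"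
  by (simp add: map_upt_Suc del: upt_Suc)

definition tuples :: "nat \<Rightarrow> 'a list set" where
  "tuples n = {x. length x = n}"

text \<open>A quantifier over tuples is a block of \<open>n\<close> quantifiers. The tail is
  quantified outside the head, so that the head lands at index \<open>0\<close> and the tuple fills
  the indices below \<open>n\<close> in order.\<close>

lemma codef_ex_list:
  assumes "codef (\<lambda>e. P (map (\<lambda>i. e i) [0..<n]) (\<lambda>i. e (i + n))) (\<lambda>e. Q (map (\<lambda>i. e i) [0..<n]) (\<lambda>i. e (i + n)))"
  shows "codef (\<lambda>e. \<exists>x. length x = n \<and> P x e) (\<lambda>e. \<exists>x. length x = n \<and> Q x e)"
  using assms
proof (induction n arbitrary: P Q)
  case 0
  then show ?case by simp
next
  case (Suc n)
  have "codef (\<lambda>e. \<exists>xs. length xs = n \<and> (\<exists>x. P (x # xs) e)) (\<lambda>e. \<exists>xs. length xs = n \<and> (\<exists>x. Q (x # xs) e))"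
  proof (rule Suc.IH)
    show "codef (\<lambda>e. \<exists>x. P (x # map (\<lambda>i. e i) [0..<n]) (\<lambda>i. e (i + n)))
                (\<lambda>e. \<exists>x. Q (x # map (\<lambda>i. e i) [0..<n]) (\<lambda>i. e (i + n)))"
      using Suc.prems unfolding map_upt_shift by (intro codef_ex) simp
  qed
  then show ?case unfolding ex_list_Suc .
qed

lemma codef_bex_tuples [codef_intros]:
  assumes "codef (\<lambda>e. P (map (\<lambda>i. e i) [0..<n]) (\<lambda>i. e (i + n))) (\<lambda>e. Q (map (\<lambda>i. e i) [0..<n]) (\<lambda>i. e (i + n)))"
  shows "codef (\<lambda>e. \<exists>x\<in>tuples n. P x e) (\<lambda>e. \<exists>x\<in>tuples n. Q x e)"
  using codef_ex_list[OF assms] by (simp add: tuples_def Bex_def)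

lemma codef_ball_tuples [codef_intros]:
  assumes "codef (\<lambda>e. P (map (\<lambda>i. e i) [0..<n]) (\<lambda>i. e (i + n))) (\<lambda>e. Q (map (\<lambda>i. e i) [0..<n]) (\<lambda>i. e (i + n)))"
  shows "codef (\<lambda>e. \<forall>x\<in>tuples n. P x e) (\<lambda>e. \<forall>x\<in>tuples n. Q x e)"
  using codef_not[OF codef_bex_tuples[of "\<lambda>x e. \<not> P x e" n "\<lambda>x e. \<not> Q x e", OF codef_not[OF assms]]] by simp

text \<open>The list has the same finitely many terms under every assignment, so the quantifier over
  its entries unfolds to a finite conjunction.\<close>

lemma codef_ball_list:
  assumes "clist n l l'"
    and P: "\<And>s s'. cterm s s' \<Longrightarrow> codef (\<lambda>e. P (s e) e) (\<lambda>e. P' (s' e) e)"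
  shows "codef (\<lambda>e. \<forall>x\<in>set (l e). P x e) (\<lambda>e. \<forall>x\<in>set (l' e). P' x e)"
  using assms(1)
proof (rule clistE)
  fix ts assume ts: "l = (\<lambda>e. map (evt e) ts)" "l' = (\<lambda>e. map (evt e) ts)"
  show ?thesis unfolding ts
  proof (induction ts)
    case Nil
    show ?case by (simp add: codef_True)
  next
    case (Cons t ts)
    have "codef (\<lambda>e. P (evt e t) e) (\<lambda>e. P' (evt e t) e)"
      by (rule P[of "\<lambda>e. evt e t" "\<lambda>e. evt e t"]) (rule cterm_evt)
    from codef_conj[OF this Cons] show ?case by simp
  qed
qed

lemma codef_map_evt_eq:
  "length ts = length us \<Longrightarrow>
    codef (\<lambda>e. map (evt e) ts = map (evt e) us) (\<lambda>e. map (evt e) ts = map (evt e) us)"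
proof (induction ts us rule: list_induct2)
  case Nil
  show ?case by (simp add: codef_True)
next
  case (Cons t ts u us)
  from codef_conj[OF codef_eq[OF cterm_evt[of t] cterm_evt[of u]] Cons.IH] show ?case by simp
qed

lemma codef_list_eq [codef_intros]:
  assumes "clist n k k'" "clist n l l'"
  shows "codef (\<lambda>e. k e = l e) (\<lambda>e. k' e = l' e)"
  using assms(1)
proof (rule clistE)
  fix ts assume ts: "length ts = n" "k = (\<lambda>e. map (evt e) ts)" "k' = (\<lambda>e. map (evt e) ts)"
  from assms(2) show ?thesis
  proof (rule clistE)
    fix us assume us: "length us = n" "l = (\<lambda>e. map (evt e) us)" "l' = (\<lambda>e. map (evt e) us)"
    show ?thesis unfolding ts us by (rule codef_map_evt_eq) (simp add: ts us)
  qed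
qed

lemma env_map_evt:
  "env (map (evt e) ts) (\<lambda>i. e (\<tau> i)) = (\<lambda>i. evt e (if i < length ts then ts ! i else TV (\<tau> i)))"
  by (auto simp: env_def)

text \<open>Allows a given formula to be used as an atom: terms are substituted for its leading
  variables, and its parameters are read off at the positions \<open>\<tau> i\<close>.\<close>

lemma codef_rsat [codef_intros]:
  assumes "clist n l l'"
  shows "codef (\<lambda>e. rsat (env (l e) (\<lambda>i. e (\<tau> i))) \<phi>) (\<lambda>e. rsat (env (l' e) (\<lambda>i. e (\<tau> i))) \<phi>)"
  using assms
proof (rule clistE)
  fix ts assume ts: "l = (\<lambda>e. map (evt e) ts)" "l' = (\<lambda>e. map (evt e) ts)"
  show ?thesis unfolding ts env_map_evt
    by (rule codefI[of "subf (\<lambda>i. if i < length ts then ts ! i else TV (\<tau> i)) \<phi>"])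
      (simp_all add: rsat_subf)
qed

lemma cterm_shift:
  assumes "cterm s s'"
  shows "cterm (\<lambda>e. s (\<lambda>i. e (Suc i))) (\<lambda>e. s' (\<lambda>i. e (Suc i)))"
proof -
  from assms obtain a where "\<forall>e. evt e a = s e" "\<forall>e. evt e a = s' e"
    unfolding cterm_def by blast
  then show ?thesis by (intro ctermI[of "subt (\<lambda>i. TV (Suc i)) a"]) (simp_all add: evt_subt)
qed

text \<open>The constant assignment follows \<open>starZ\<close>; membership of a term is then
  expressed by substituting it for every variable.\<close>

definition zset :: "rfm \<Rightarrow> 'a::comm_ring_1 set" where
  "zset \<phi> = {a. rsat (\<lambda>_. a) \<phi>}"

lemma codef_zset [codef_intros]:
  assumes "cterm s s'"
  shows "codef (\<lambda>e. s e \<in> zset \<phi>) (\<lambda>e. s' e \<in> zset \<phi>)"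
proof -
  from assms obtain a where "\<forall>e. evt e a = s e" "\<forall>e. evt e a = s' e"
    unfolding cterm_def by blast
  then show ?thesis
    by (intro codefI[of "subf (\<lambda>_. a) \<phi>"]) (simp_all add: rsat_subf zset_def)
qed

section \<open>Transfer from the rationals to models of their theory\<close>

fun exs :: "nat list \<Rightarrow> rfm \<Rightarrow> rfm" where
  "exs [] p = p"
| "exs (x # xs) p = FEx x (exs xs p)"

lemma fvf_exs: "fvf (exs xs p) = fvf p - set xs"
  by (induction xs) auto

lemma rsat_exs: "(\<And>i. i \<notin> set xs \<Longrightarrow> e' i = e i) \<Longrightarrow> rsat e' p \<Longrightarrow> rsat e (exs xs p)"
proof (induction xs arbitrary: e)
  case Nil
  then have "e' = e" by auto
  with Nil show ?case by simp
next
  case (Cons x xs)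
  have "rsat (e(x := e' x)) (exs xs p)"
    by (rule Cons.IH) (use Cons.prems in auto)
  then show ?case by auto
qed

lemma rsat_exsD:
  fixes e :: "nat \<Rightarrow> 'a::comm_ring_1"
  shows "rsat e (exs xs p) \<Longrightarrow> \<exists>e'::nat \<Rightarrow> 'a. rsat e' p"
  by (induction xs arbitrary: e) auto

text \<open>A failure of \<open>Q\<close> satisfies the existential closure of the negated formula.
  This closure is a sentence, so it holds in the rationals as well and contradicts
  \<open>P\<close>.\<close>

lemma ThQ_transfer:
  fixes Q :: "(nat \<Rightarrow> 'a::comm_ring_1) \<Rightarrow> bool" and P :: "(nat \<Rightarrow> rat) \<Rightarrow> bool"
  assumes T: "ThQ_model TYPE('a)" and PQ: "codef P Q" and P: "\<And>e. P e"
  shows "Q e"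
  using PQ
proof (rule codefE)
  fix \<phi> assume \<phi>: "\<And>e. rsat e \<phi> = P e" "\<And>e. rsat e \<phi> = Q e"
  show "Q e"
  proof (rule ccontr)
    assume "\<not> Q e"
    obtain xs where xs: "set xs = fvf \<phi>" using finite_list[OF finite_fvf] by blast
    let ?\<chi> = "exs xs (FNot \<phi>)"
    \<comment> \<open>The value \<open>0\<close> off the free variables matches the assignment at
      which \<open>ThQ_model\<close> evaluates sentences, as \<open>rsat_exs\<close>
      demands.\<close>
    let ?e = "\<lambda>i. if i \<in> set xs then e i else 0"
    have "rsat e \<phi> = rsat ?e \<phi>" by (rule rsat_cong) (simp add: xs)
    then have "rsat ?e (FNot \<phi>)"
      using \<open>\<not> Q e\<close> by (simp add: \<phi>(2))
    then have "rsat (\<lambda>_. 0::'a) ?\<chi>" by (rule rsat_exs[rotated]) simp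
    moreover have "\<not> rsat (\<lambda>_. 0::rat) ?\<chi>"
    proof
      assume "rsat (\<lambda>_. 0::rat) ?\<chi>"
      then obtain e' :: "nat \<Rightarrow> rat" where "rsat e' (FNot \<phi>)" using rsat_exsD by blast
      then show False by (simp add: \<phi>(1) P)
    qed
    moreover have "fvf ?\<chi> = {}" by (simp add: fvf_exs xs)
    ultimately show False using T unfolding ThQ_model_def by blast
  qed
qed

section \<open>Coding finite sets of rational tuples\<close>

fun horner :: "'a::comm_ring_1 \<Rightarrow> 'a list \<Rightarrow> 'a" where
  "horner c [] = 0"
| "horner c (x # xs) = x + c * horner c xs"

text \<open>The condition that \<open>2 d x + 1\<close> divides \<open>w \<noteq> 0\<close> bounds the entries \<open>x\<close> without mentioning an order
  (and is meaningful for \<open>x = 0\<close>); among the finitely many tuples left, the divisors of \<open>m\<close> are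
  selected, where \<open>c0 + c1 * horner c v\<close> takes pairwise coprime values.\<close>
definition coded_mem ::
    "'a::comm_ring_1 set \<Rightarrow> 'a \<Rightarrow> 'a \<Rightarrow> 'a \<Rightarrow> 'a \<Rightarrow> 'a \<Rightarrow> 'a \<Rightarrow> 'a list \<Rightarrow> bool" where
  "coded_mem Z d w m c0 c1 c v \<longleftrightarrow>
     (\<forall>x\<in>set v. d * x \<in> Z \<and> (\<exists>t. t \<in> Z \<and> (2 * (d * x) + 1) * t = w)) \<and>
     (\<exists>t. t \<in> Z \<and> (c0 + c1 * horner c v) * t = m)"

section \<open>Arithmetic of balanced expansions, denominators and coprime moduli\<close>

text \<open>Uniqueness of expansions with balanced digits: leading entries differ by at most
  \<open>2 * B\<close> and by a multiple of \<open>c = 2 * B + 1\<close>, so they agree and can be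
  stripped.\<close>

lemma horner_int_inj:
  fixes xs ys :: "int list"
  assumes "length xs = length ys" "\<forall>x\<in>set xs. \<bar>x\<bar> \<le> B" "\<forall>y\<in>set ys. \<bar>y\<bar> \<le> B"
    and "c = 2 * B + 1" "horner c xs = horner c ys"
  shows "xs = ys"
  using assms
proof (induction xs ys rule: list_induct2)
  case (Cons x xs y ys)
  have eq: "x - y = c * (horner c ys - horner c xs)"
    using Cons.prems(4) by (simp add: algebra_simps)
  have "x = y"
  proof (rule ccontr)
    assume "x \<noteq> y"
    then have "\<bar>c\<bar> \<le> \<bar>x - y\<bar>"
      using eq by (intro dvd_imp_le_int) auto
    then show False using Cons.prems(1-3) by auto
  qed
  moreover from this have "horner c xs = horner c ys"
    using Cons.prems(1,3) eq by auto
  ultimately show ?case using Cons by auto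
qed auto

lemma common_denominator:
  fixes F :: "rat set"
  assumes "finite F"
  shows "\<exists>d::int. d > 0 \<and> (\<forall>x\<in>F. of_int d * x \<in> \<int>)"
  using assms
proof (induction F rule: finite_induct)
  case (insert x F)
  then obtain d :: int where d: "d > 0" "\<forall>x\<in>F. of_int d * x \<in> \<int>" by blast
  obtain p q where pq: "x = Fract p q" "q > 0" by (cases x) auto
  have x: "of_int q * x = of_int p" using pq by (simp add: Fract_of_int_quotient)
  show ?case
  proof (intro exI[of _ "d * q"] conjI ballI)
    fix y assume "y \<in> insert x F"
    then show "of_int (d * q) * y \<in> \<int>"
    proof
      assume "y = x"
      then have "of_int (d * q) * y = of_int (d * p)" using x by (simp add: mult.assoc)
      then show ?thesis by (simp only: Ints_of_int)
    next
      assume "y \<in> F"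
      then have "of_int q * (of_int d * y) \<in> \<int>" using d(2) by (auto intro!: Ints_mult[OF Ints_of_int, of "of_int d * y" q])
      then show ?thesis by (simp add: mult_ac)
    qed
  qed (use d pq in simp)
qed (auto intro: exI[of _ 1])

text \<open>The coprimality behind the beta function. A common divisor is prime to \<open>w\<close>
  and divides \<open>w * (a - b)\<close>, hence divides \<open>a - b\<close> and so
  \<open>w\<close>.\<close>

lemma coprime_one_plus_mult:
  fixes a b w :: int
  assumes "(a - b) dvd w"
  shows "coprime (1 + w * a) (1 + w * b)"
proof (rule coprimeI)
  fix g assume g: "g dvd 1 + w * a" "g dvd 1 + w * b"
  have "coprime g w"
  proof (rule coprimeI)
    fix h assume "h dvd g" "h dvd w"
    then have "h dvd 1 + w * a" "h dvd w * a" using g(1) by auto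
    then show "is_unit h" by (simp add: dvd_add_left_iff)
  qed
  moreover have "g dvd (1 + w * a) - (1 + w * b)" using g by (rule dvd_diff)
  then have "g dvd w * (a - b)" by (simp add: algebra_simps)
  ultimately have "g dvd w"
    using assms by (metis coprime_dvd_mult_right_iff dvd_trans)
  with \<open>coprime g w\<close> show "is_unit g" by (simp add: coprime_absorb_left)
qed

text \<open>A divisor of a nonzero integer is bounded by it, and
  \<open>\<bar>m\<bar> \<le> \<bar>2 * m + 1\<bar>\<close> for every integer.\<close>

lemma abs_le_of_odd_dvd:
  fixes m w :: int
  assumes "(2 * m + 1) dvd w" "w \<noteq> 0"
  shows "\<bar>m\<bar> \<le> \<bar>w\<bar>"
proof -
  have "\<bar>2 * m + 1\<bar> \<le> \<bar>w\<bar>" using assms by (simp add: dvd_imp_le_int)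
  then show ?thesis by linarith
qed

section \<open>Finite sets are exactly what can be coded\<close>

text \<open>Each entry of a coded tuple has the form \<open>k / d\<close> with \<open>k\<close>
  bounded by \<open>w\<close>. This rules out coding an infinite orbit of a group element.\<close>

lemma finite_coded:
  fixes d w :: rat
  assumes "d \<noteq> 0" "w \<noteq> 0"
  shows "finite {v. length v = N \<and> coded_mem \<int> d w m c0 c1 c v}"
proof -
  define F where "F = {x. d * x \<in> \<int> \<and> (\<exists>t. t \<in> \<int> \<and> (2 * (d * x) + 1) * t = w)}"
  have F: "x \<in> (\<lambda>k. of_int k / d) ` {- \<bar>\<lfloor>w\<rfloor>\<bar>..\<bar>\<lfloor>w\<rfloor>\<bar>}" if "x \<in> F" for x
  proof -
    from that obtain t' where t': "d * x \<in> \<int>" "t' \<in> \<int>" "(2 * (d * x) + 1) * t' = w"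
      unfolding F_def by blast
    obtain k where k: "d * x = of_int k" using t'(1) by (rule Ints_cases)
    obtain t where "t' = of_int t" using t'(2) by (rule Ints_cases)
    then have w: "w = of_int ((2 * k + 1) * t)" using t'(3) k by simp
    then have "\<lfloor>w\<rfloor> = (2 * k + 1) * t" by (simp only: floor_of_int)
    moreover have "(2 * k + 1) * t \<noteq> 0" using w assms(2) by (metis of_int_0)
    ultimately have "\<bar>k\<bar> \<le> \<bar>\<lfloor>w\<rfloor>\<bar>"
      by (intro abs_le_of_odd_dvd) auto
    moreover have "x = of_int k / d" using k assms(1) by (simp add: field_simps)
    ultimately show ?thesis by (intro image_eqI[of _ _ k]) auto
  qed
  then have "finite F" by (meson finite_atLeastAtMost_int finite_imageI finite_subset subsetI)
  then have "finite {v. set v \<subseteq> F \<and> length v = N}" by (rule finite_lists_length_eq)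
  then show ?thesis
    by (rule rev_finite_subset) (auto simp: coded_mem_def F_def)
qed

text \<open>\<open>horner\<close> is linear in its list, so clearing denominators in the entries
  scales the value by the same factor.\<close>

lemma horner_scaled:
  fixes d :: rat
  assumes "\<forall>x\<in>set v. d * x \<in> \<int>"
  shows "d * horner (of_int c) v = of_int (horner c (map (\<lambda>x. \<lfloor>d * x\<rfloor>) v))"
  using assms by (induction v) (auto simp: algebra_simps floor_of_int elim!: Ints_cases)

text \<open>The entry conditions cut out a finite set \<open>Y\<close> containing \<open>X\<close>.
  On \<open>Y\<close> the numbers \<open>E v\<close> are pairwise coprime and at least 2, so
  divisibility of their product over \<open>X\<close> recovers \<open>X\<close>.\<close>

lemma ex_code:
  fixes X :: "rat list set"
  assumes "finite X" "\<forall>v\<in>X. length v = N"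
  shows "\<exists>d w m c0 c1 c. d \<noteq> 0 \<and> w \<noteq> 0 \<and>
    (\<forall>v. length v = N \<longrightarrow> coded_mem \<int> d w m c0 c1 c v = (v \<in> X))"
proof -
  define F where "F = (\<Union>v\<in>X. set v)"
  have "finite F" using assms by (simp add: F_def)
  then obtain d :: int where d: "d > 0" "\<forall>x\<in>F. of_int d * x \<in> \<int>"
    using common_denominator by blast
  define fl where "fl x = \<lfloor>of_int d * x\<rfloor>" for x :: rat
  have fl: "of_int d * x = of_int (fl x)" if "of_int d * x \<in> \<int>" for x
    using that by (auto simp: fl_def elim!: Ints_cases)
  \<comment> \<open>Each entry occurring in \<open>X\<close> contributes its own odd factor and so
    passes the divisibility test; odd factors keep \<open>w\<close> nonzero.\<close>
  define w where "w = (\<Prod>x\<in>F. 2 * fl x + 1)"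
  have "2 * fl x + 1 \<noteq> 0" for x by presburger
  then have w0: "w \<noteq> 0" using \<open>finite F\<close> by (simp add: w_def)
  define Y where "Y = {v. length v = N \<and> (\<forall>x\<in>set v. of_int d * x \<in> \<int> \<and> (2 * fl x + 1) dvd w)}"
  have bound: "\<bar>fl x\<bar> \<le> \<bar>w\<bar>" if "v \<in> Y" "x \<in> set v" for v x
    using that w0 by (intro abs_le_of_odd_dvd) (auto simp: Y_def)
  have inj_fl: "inj_on fl {x. of_int d * x \<in> \<int>}"
  proof (rule inj_onI)
    fix x y assume "x \<in> {x. of_int d * x \<in> \<int>}" "y \<in> {x. of_int d * x \<in> \<int>}" "fl x = fl y"
    then have "of_int d * x = of_int d * y" using fl[of x] fl[of y] by (simp only: mem_Collect_eq)
    then show "x = y" using d(1) by simp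
  qed
  have "Y \<subseteq> {v. set v \<subseteq> {x. of_int d * x \<in> \<int>} \<inter> fl -` {-\<bar>w\<bar>..\<bar>w\<bar>} \<and> length v = N}"
  proof
    fix v assume v: "v \<in> Y"
    have "-\<bar>w\<bar> \<le> fl x \<and> fl x \<le> \<bar>w\<bar>" if "x \<in> set v" for x
      using bound[OF v that] by (simp add: abs_le_iff)
    then show "v \<in> {v. set v \<subseteq> {x. of_int d * x \<in> \<int>} \<inter> fl -` {-\<bar>w\<bar>..\<bar>w\<bar>} \<and> length v = N}"
      using v by (auto simp: Y_def)
  qed
  moreover have "finite ({x. of_int d * x \<in> \<int>} \<inter> fl -` {-\<bar>w\<bar>..\<bar>w\<bar>})"
    by (subst Int_commute) (rule finite_vimage_IntI[OF finite_atLeastAtMost_int inj_fl])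
  ultimately have finY: "finite Y"
    by (rule finite_subset[OF _ finite_lists_length_eq])
  have XY: "X \<subseteq> Y"
  proof
    fix v assume "v \<in> X"
    then have "set v \<subseteq> F" by (auto simp: F_def)
    moreover have "(2 * fl x + 1) dvd w" if "x \<in> F" for x
      unfolding w_def using \<open>finite F\<close> that by (rule dvd_prodI)
    ultimately show "v \<in> Y" using \<open>v \<in> X\<close> assms(2) d(2) by (auto simp: Y_def)
  qed
  \<comment> \<open>The integers \<open>fl x\<close> for entries of tuples in \<open>Y\<close> lie
    between \<open>-\<bar>w\<bar>\<close> and \<open>\<bar>w\<bar>\<close>, so in this base they are
    balanced digits and \<open>H\<close> is injective on \<open>Y\<close>.\<close>
  define c where "c = 2 * \<bar>w\<bar> + 1"
  define H where "H v = horner c (map fl v)" for v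
  have inj_H: "inj_on H Y"
  proof (rule inj_onI)
    fix u v assume uv: "u \<in> Y" "v \<in> Y" "H u = H v"
    have "map fl u = map fl v"
      by (rule horner_int_inj[of _ _ "\<bar>w\<bar>" c]) (use uv bound in \<open>auto simp: c_def H_def Y_def\<close>)
    then show "u = v"
      by (rule map_inj_on) (rule inj_on_subset[OF inj_fl], use uv in \<open>auto simp: Y_def\<close>)
  qed
  \<comment> \<open>\<open>K\<close> exceeds every \<open>\<bar>H v\<bar>\<close>: the shifted
    values \<open>K + H v\<close> are positive, and their differences are at most
    \<open>2 * K\<close> in size, hence divide the factorial \<open>w2\<close>.\<close>
  define K where "K = 1 + (\<Sum>v\<in>Y. \<bar>H v\<bar>)"
  have K: "\<bar>H v\<bar> < K" if "v \<in> Y" for v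
    using member_le_sum[OF that, of "\<lambda>v. \<bar>H v\<bar>"] finY by (simp add: K_def)
  define w2 where "w2 = (fact (nat (2 * K)) :: int)"
  define E where "E v = 1 + w2 * (K + H v)" for v
  have E2: "E v \<ge> 2" if "v \<in> Y" for v
  proof -
    have "w2 \<ge> 1" by (simp add: w2_def)
    moreover have "K + H v \<ge> 1" using K[OF that] by linarith
    ultimately have "1 * 1 \<le> w2 * (K + H v)" by (intro mult_mono) auto
    then show ?thesis by (simp add: E_def)
  qed
  have cop: "coprime (E u) (E v)" if "u \<in> Y" "v \<in> Y" "u \<noteq> v" for u v
    unfolding E_def
  proof (rule coprime_one_plus_mult)
    have "H u \<noteq> H v" using that inj_H by (auto dest: inj_onD)
    then have "1 \<le> \<bar>H u - H v\<bar>" "\<bar>H u - H v\<bar> \<le> 2 * K"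
      using K[OF that(1)] K[OF that(2)] by linarith+
    then have "nat \<bar>H u - H v\<bar> dvd fact (nat (2 * K))"
      by (intro dvd_fact) auto
    then have "int (nat \<bar>H u - H v\<bar>) dvd int (fact (nat (2 * K)))" by (simp only: int_dvd_int_iff)
    then show "(K + H u - (K + H v)) dvd w2" by (simp add: w2_def)
  qed
  define m where "m = (\<Prod>v\<in>X. E v)"
  have dvd: "E v dvd m \<longleftrightarrow> v \<in> X" if "v \<in> Y" for v
  proof
    assume "E v dvd m"
    show "v \<in> X"
    proof (rule ccontr)
      assume "v \<notin> X"
      then have "coprime (E v) m" unfolding m_def
        using cop that XY by (intro prod_coprime_right) auto
      then have "is_unit (E v)" using \<open>E v dvd m\<close> by (simp add: coprime_absorb_left)
      then show False using E2[OF that] by simp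
    qed
  next
    assume "v \<in> X"
    then show "E v dvd m" unfolding m_def using assms(1) by (intro dvd_prodI) auto
  qed
  have dvd_rat: "(\<exists>t. t \<in> \<int> \<and> of_int a * t = (of_int b :: rat)) \<longleftrightarrow> a dvd b" for a b
  proof -
    have "(\<exists>t. t \<in> \<int> \<and> of_int a * t = (of_int b :: rat)) \<longleftrightarrow> (\<exists>k. of_int (a * k) = (of_int b :: rat))"
      unfolding of_int_mult by (blast elim: Ints_cases intro: Ints_of_int)
    then show ?thesis unfolding of_int_eq_iff dvd_def by auto
  qed
  \<comment> \<open>The constants are chosen so that \<open>c0 + c1 * horner c v\<close> equals
    \<open>E v\<close>; the factor \<open>d\<close> in \<open>c1\<close> clears the denominators of
    \<open>v\<close>.\<close>
  have "coded_mem \<int> (of_int d) (of_int w) (of_int m) (of_int (1 + w2 * K)) (of_int (w2 * d)) (of_int c) v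
      \<longleftrightarrow> v \<in> X" if len: "length v = N" for v :: "rat list"
  proof -
    have odd: "(\<exists>t. t \<in> \<int> \<and> (2 * (of_int d * x) + 1) * t = of_int w) \<longleftrightarrow> (2 * fl x + 1) dvd w"
      if "of_int d * x \<in> \<int>" for x
      unfolding fl[OF that] dvd_rat[symmetric] by simp
    have first: "(\<forall>x\<in>set v. of_int d * x \<in> \<int> \<and>
        (\<exists>t. t \<in> \<int> \<and> (2 * (of_int d * x) + 1) * t = of_int w)) \<longleftrightarrow> v \<in> Y"
      using odd len unfolding Y_def mem_Collect_eq by blast
    have second: "of_int (1 + w2 * K) + of_int (w2 * d) * horner (of_int c) v = of_int (E v)"
      if "v \<in> Y"
    proof -
      have "of_int d * horner (of_int c) v = of_int (H v)"
        unfolding H_def fl_def using that by (intro horner_scaled) (auto simp: Y_def)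
      then have "of_int (w2 * d) * horner (of_int c) v = of_int w2 * of_int (H v)"
        by (simp add: mult.assoc)
      then show ?thesis by (simp add: E_def algebra_simps)
    qed
    show ?thesis
    proof (cases "v \<in> Y")
      case True
      then show ?thesis
        unfolding coded_mem_def first by (simp only: second dvd_rat dvd simp_thms)
    next
      case False
      then show ?thesis unfolding coded_mem_def first using XY by blast
    qed
  qed
  moreover have "of_int d \<noteq> (0::rat)" "of_int w \<noteq> (0::rat)" using d w0 by auto
  ultimately show ?thesis by blast
qed

section \<open>Multiples in definable groups\<close>

lemma cterm_horner [codef_intros]:
  assumes "cterm c c'" "clist n l l'"
  shows "cterm (\<lambda>e. horner (c e) (l e)) (\<lambda>e. horner (c' e) (l' e))"
  using assms(2)
proof (rule clistE)
  fix ts assume ts: "l = (\<lambda>e. map (evt e) ts)" "l' = (\<lambda>e. map (evt e) ts)"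
  show ?thesis unfolding ts
    by (induction ts) (simp_all add: cterm_zero cterm_add cterm_mult cterm_evt assms(1))
qed

lemma codef_ex_factor:
  assumes "cterm s s'" "cterm t t'"
  shows "codef (\<lambda>e. \<exists>k. k \<in> zset \<phi> \<and> s e * k = t e) (\<lambda>e. \<exists>k. k \<in> zset \<phi> \<and> s' e * k = t' e)"
  by (rule codef_ex, intro codef_conj codef_zset codef_eq cterm_mult cterm_shift cterm_var assms)

lemma codef_coded_mem [codef_intros]:
  assumes "cterm d d'" "cterm w w'" "cterm m m'" "cterm c0 c0'" "cterm c1 c1'" "cterm c c'" "clist n l l'"
  shows "codef (\<lambda>e. coded_mem (zset \<phi>) (d e) (w e) (m e) (c0 e) (c1 e) (c e) (l e))
    (\<lambda>e. coded_mem (zset \<phi>) (d' e) (w' e) (m' e) (c0' e) (c1' e) (c' e) (l' e))"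
  unfolding coded_mem_def
  by (intro codef_conj codef_ball_list codef_ex_factor codef_zset cterm_mult cterm_add
      cterm_numeral cterm_one cterm_horner assms(1-6); (assumption | rule assms(7)))

section \<open>Multiples, groups and modules as first-order relations\<close>

text \<open>\<open>S\<close> stands for a finite set of pairs of an index \<open>i\<close> and a tuple \<open>z\<close>, stored as \<open>i # z\<close>; the unit of
  the group is the only \<open>u\<close> with \<open>G u u u\<close>.\<close>
definition reaches ::
    "nat \<Rightarrow> ('a::comm_ring_1 list \<Rightarrow> 'a list \<Rightarrow> 'a list \<Rightarrow> bool) \<Rightarrow> ('a list \<Rightarrow> 'a list \<Rightarrow> bool) \<Rightarrow>
      'a \<Rightarrow> 'a \<Rightarrow> 'a list \<Rightarrow> ('a list \<Rightarrow> bool) \<Rightarrow> bool" where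
  "reaches n G H h k y S \<longleftrightarrow>
     ((\<forall>u\<in>tuples n. G u u u \<longrightarrow> S (0 # u)) \<and>
      (\<forall>i. \<forall>z\<in>tuples n. \<forall>z'\<in>tuples n. S (i # z) \<and> i \<noteq> k \<and> H z z' \<longrightarrow> S ((i + h) # z'))) \<longrightarrow>
     S (k # y)"

text \<open>The second clause steps back by \<open>x\<close> without naming an inverse. The
  conditions on \<open>d\<close> and \<open>w\<close> confine the codes, over the rationals, to
  finite sets.\<close>

definition multiple_rel ::
    "nat \<Rightarrow> 'a::comm_ring_1 set \<Rightarrow> ('a list \<Rightarrow> 'a list \<Rightarrow> 'a list \<Rightarrow> bool) \<Rightarrow> 'a \<Rightarrow> 'a list \<Rightarrow> 'a list \<Rightarrow> bool" where
  "multiple_rel n Z G k x y \<longleftrightarrow>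
     (\<forall>d w m c0 c1 c. d \<noteq> 0 \<and> w \<noteq> 0 \<longrightarrow>
        reaches n G (\<lambda>z z'. G z x z') 1 k y (\<lambda>v. coded_mem Z d w m c0 c1 c v) \<and>
        reaches n G (\<lambda>z z'. G z' x z) (-1) k y (\<lambda>v. coded_mem Z d w m c0 c1 c v))"

definition group_rel ::
    "nat \<Rightarrow> ('a list \<Rightarrow> bool) \<Rightarrow> ('a list \<Rightarrow> 'a list \<Rightarrow> 'a list \<Rightarrow> bool) \<Rightarrow> bool" where
  "group_rel n A G \<longleftrightarrow>
     (\<forall>x\<in>tuples n. \<forall>y\<in>tuples n. \<forall>z\<in>tuples n. G x y z \<longrightarrow> A x \<and> A y \<and> A z) \<and>
     (\<forall>x\<in>tuples n. \<forall>y\<in>tuples n. A x \<and> A y \<longrightarrow> (\<exists>z\<in>tuples n. G x y z)) \<and>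
     (\<forall>x\<in>tuples n. \<forall>y\<in>tuples n. \<forall>z\<in>tuples n. \<forall>w\<in>tuples n. G x y z \<and> G x y w \<longrightarrow> z = w) \<and>
     (\<forall>x\<in>tuples n. \<forall>y\<in>tuples n. \<forall>z\<in>tuples n. G x y z \<longrightarrow> G y x z) \<and>
     (\<forall>x\<in>tuples n. \<forall>y\<in>tuples n. \<forall>z\<in>tuples n. \<forall>r\<in>tuples n. \<forall>s\<in>tuples n. \<forall>t\<in>tuples n.
        G x y r \<and> G r z t \<and> G y z s \<longrightarrow> G x s t) \<and>
     (\<exists>u\<in>tuples n. A u \<and> (\<forall>x\<in>tuples n. A x \<longrightarrow> G u x x \<and> (\<exists>y\<in>tuples n. G y x u)))"

text \<open>Closure under differences supplies zero and the negative integers. Agreement with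
  integer powers is not a clause, since it follows from additivity and
  \<open>M 1 x x\<close>.\<close>

definition module_rel ::
    "nat \<Rightarrow> 'a::comm_ring_1 set \<Rightarrow> ('a list \<Rightarrow> bool) \<Rightarrow> ('a list \<Rightarrow> 'a list \<Rightarrow> 'a list \<Rightarrow> bool) \<Rightarrow>
      ('a \<Rightarrow> 'a list \<Rightarrow> 'a list \<Rightarrow> bool) \<Rightarrow> bool" where
  "module_rel n Z A G M \<longleftrightarrow>
     1 \<in> Z \<and> (\<forall>r s. r \<in> Z \<and> s \<in> Z \<longrightarrow> r + s \<in> Z \<and> r - s \<in> Z \<and> r * s \<in> Z) \<and>
     (\<forall>r. \<forall>x\<in>tuples n. r \<in> Z \<and> A x \<longrightarrow>
        (\<exists>y\<in>tuples n. A y \<and> M r x y \<and> (\<forall>z\<in>tuples n. A z \<and> M r x z \<longrightarrow> z = y))) \<and>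
     (\<forall>r s. \<forall>x\<in>tuples n. \<forall>y\<in>tuples n. \<forall>z\<in>tuples n. \<forall>w\<in>tuples n.
        r \<in> Z \<and> s \<in> Z \<and> A x \<and> A y \<and> A z \<and> A w \<and> M r x y \<and> M s x z \<and> M (r + s) x w \<longrightarrow> G y z w) \<and>
     (\<forall>r. \<forall>x\<in>tuples n. \<forall>x'\<in>tuples n. \<forall>x''\<in>tuples n. \<forall>y\<in>tuples n. \<forall>y'\<in>tuples n. \<forall>y''\<in>tuples n.
        r \<in> Z \<and> G x x' x'' \<and> A y \<and> A y' \<and> A y'' \<and> M r x y \<and> M r x' y' \<and> M r x'' y'' \<longrightarrow> G y y' y'') \<and>
     (\<forall>r s. \<forall>x\<in>tuples n. \<forall>y\<in>tuples n. \<forall>z\<in>tuples n.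
        r \<in> Z \<and> s \<in> Z \<and> A x \<and> A y \<and> A z \<and> M s x y \<and> M r y z \<longrightarrow> M (r * s) x z) \<and>
     (\<forall>x\<in>tuples n. A x \<longrightarrow> M 1 x x)"

text \<open>Even and odd indices hold the parameters of \<open>\<phi>\<close> and \<open>\<psi>\<close>, so that one assignment serves both.\<close>
lemma codef_group_module:
  "codef
    (\<lambda>e::nat \<Rightarrow> 'a::comm_ring_1.
      group_rel n (\<lambda>x. rsat (env x (\<lambda>i. e (2 * i))) \<phi>)
        (\<lambda>x y z. rsat (env (x @ y @ z) (\<lambda>i. e (2 * i + 1))) \<psi>) \<longrightarrow>
      module_rel n (zset \<zeta>) (\<lambda>x. rsat (env x (\<lambda>i. e (2 * i))) \<phi>)
        (\<lambda>x y z. rsat (env (x @ y @ z) (\<lambda>i. e (2 * i + 1))) \<psi>)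
        (multiple_rel n (zset \<zeta>) (\<lambda>x y z. rsat (env (x @ y @ z) (\<lambda>i. e (2 * i + 1))) \<psi>)))
    (\<lambda>e::nat \<Rightarrow> 'b::comm_ring_1.
      group_rel n (\<lambda>x. rsat (env x (\<lambda>i. e (2 * i))) \<phi>)
        (\<lambda>x y z. rsat (env (x @ y @ z) (\<lambda>i. e (2 * i + 1))) \<psi>) \<longrightarrow>
      module_rel n (zset \<zeta>) (\<lambda>x. rsat (env x (\<lambda>i. e (2 * i))) \<phi>)
        (\<lambda>x y z. rsat (env (x @ y @ z) (\<lambda>i. e (2 * i + 1))) \<psi>)
        (multiple_rel n (zset \<zeta>) (\<lambda>x y z. rsat (env (x @ y @ z) (\<lambda>i. e (2 * i + 1))) \<psi>)))"
  unfolding group_rel_def module_rel_def multiple_rel_def reaches_def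
  by (intro codef_intros; (rule clist_append clist_map clist_cons codef_intros)+)

section \<open>Multiples over the rationals\<close>

text \<open>\<open>p\<close> is the orbit of the unit under \<open>H\<close>. If index
  \<open>K\<close> is hit at \<open>j\<close>, a closed set must contain the orbit up to
  \<open>E j\<close>, and this initial segment is itself closed and codable. If it is never hit, a
  closed set would contain the infinite orbit, so no code is closed and the condition is
  vacuous.\<close>

lemma reaches_iff:
  fixes Z :: "rat set" and K :: int
  assumes Z: "Z = \<int>"
    and u: "u \<in> tuples n" "\<And>v. v \<in> tuples n \<Longrightarrow> G v v v \<longleftrightarrow> v = u"
    and p: "p 0 = u" "\<And>j. p j \<in> tuples n"
    and H: "\<And>j z. z \<in> tuples n \<Longrightarrow> H (p j) z \<longleftrightarrow> z = p (Suc j)"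
    and h: "h = 1 \<or> h = (-1::int)" and y: "y \<in> tuples n"
  shows "(\<forall>d w m c0 c1 c. d \<noteq> 0 \<and> w \<noteq> 0 \<longrightarrow>
            reaches n G H (of_int h) (of_int K) y (\<lambda>v. coded_mem Z d w m c0 c1 c v)) \<longleftrightarrow>
         (\<forall>j. K = h * int j \<longrightarrow> y = p j)"
proof -
  define E where "E j = (of_int (h * int j) :: rat) # p j" for j
  have E0: "E 0 = 0 # u" by (simp add: E_def p)
  have ESuc: "(of_int (h * int j) + of_int h) # p (Suc j) = E (Suc j)" for j
    by (simp add: E_def algebra_simps)
  have injE: "inj E"
    by (rule injI) (use h in \<open>auto simp: E_def\<close>)
  have EK: "E j = of_int K # x \<longleftrightarrow> K = h * int j \<and> x = p j" for j x
    by (auto simp: E_def simp del: of_int_mult)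
  have lenE: "length (E j) = Suc n" for j
    using p(2)[of j] by (simp add: E_def tuples_def)
  \<comment> \<open>Closure is only required at indices other than \<open>K\<close>, so the walk
    reaches \<open>E j\<close> provided \<open>K\<close> was not met strictly before.\<close>
  have all: "S (E j)"
    if S: "\<forall>v\<in>tuples n. G v v v \<longrightarrow> S (0 # v)"
      "\<forall>i. \<forall>z\<in>tuples n. \<forall>z'\<in>tuples n. S (i # z) \<and> i \<noteq> of_int K \<and> H z z' \<longrightarrow> S ((i + of_int h) # z')"
      and j: "\<And>i. i < j \<Longrightarrow> K \<noteq> h * int i" for S j
    using j
  proof (induction j)
    case 0
    then show ?case using S(1) u by (simp add: E0)
  next
    case (Suc j)
    have "S (of_int (h * int j) # p j)" using Suc by (simp add: E_def)
    moreover have "of_int (h * int j) \<noteq> (of_int K :: rat)"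
      using Suc.prems[of j] unfolding of_int_eq_iff by auto
    moreover have "H (p j) (p (Suc j))" using H p(2) by blast
    ultimately have "S ((of_int (h * int j) + of_int h) # p (Suc j))" using S(2) p(2) by blast
    then show ?case by (simp only: ESuc)
  qed
  show ?thesis
  proof (cases "\<exists>j. K = h * int j")
    case True
    then obtain j where j: "K = h * int j" by blast
    have uniq: "K = h * int i \<longleftrightarrow> i = j" for i using h j by auto
    show ?thesis
    proof
      assume L: "\<forall>d w m c0 c1 c. d \<noteq> 0 \<and> w \<noteq> 0 \<longrightarrow>
        reaches n G H (of_int h) (of_int K) y (\<lambda>v. coded_mem Z d w m c0 c1 c v)"
      \<comment> \<open>The test set is the smallest closed one: the orbit up to index
        \<open>K\<close>. Membership of \<open>K # y\<close> in it leaves only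
        \<open>y = p j\<close>.\<close>
      have "finite (E ` {..j})" "\<forall>v\<in>E ` {..j}. length v = Suc n" using lenE by auto
      from ex_code[OF this] obtain d w m c0 c1 c where
        c: "d \<noteq> 0" "w \<noteq> 0" "\<And>v. length v = Suc n \<Longrightarrow> coded_mem \<int> d w m c0 c1 c v \<longleftrightarrow> v \<in> E ` {..j}"
        by metis
      define S where "S = coded_mem Z d w m c0 c1 c"
      have S: "S (i # z) \<longleftrightarrow> i # z \<in> E ` {..j}" if "z \<in> tuples n" for i z
        unfolding S_def Z using that by (intro c) (simp add: tuples_def)
      have "reaches n G H (of_int h) (of_int K) y S"
        unfolding S_def using L c by blast
      moreover have "\<forall>v\<in>tuples n. G v v v \<longrightarrow> S (0 # v)"
        using u S E0 by (metis atMost_iff image_eqI zero_le)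
      moreover have "\<forall>i. \<forall>z\<in>tuples n. \<forall>z'\<in>tuples n.
          S (i # z) \<and> i \<noteq> of_int K \<and> H z z' \<longrightarrow> S ((i + of_int h) # z')"
      proof (intro allI ballI impI, elim conjE)
        fix i z z' assume z: "z \<in> tuples n" "z' \<in> tuples n" and "S (i # z)" "i \<noteq> of_int K" "H z z'"
        then obtain k where k: "k \<le> j" "i # z = E k" using S by blast
        then have "i = of_int (h * int k)" "z = p k" by (simp_all add: E_def)
        \<comment> \<open>Stopping at \<open>K\<close> is what closes the segment: the last element
          \<open>E j\<close> needs no successor.\<close>
        moreover have "k \<noteq> j" using \<open>i \<noteq> of_int K\<close> calculation j by auto
        ultimately have "(i + of_int h) # z' = E (Suc k)" "Suc k \<le> j"
          using H[OF z(2), of k] \<open>H z z'\<close> k(1) ESuc[of k] by auto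
        then show "S ((i + of_int h) # z')" using S z(2) by blast
      qed
      ultimately have "S (of_int K # y)" unfolding reaches_def by blast
      then have "of_int K # y \<in> E ` {..j}" using S y by blast
      then show "\<forall>i. K = h * int i \<longrightarrow> y = p i" using EK uniq by (metis imageE)
    next
      assume "\<forall>i. K = h * int i \<longrightarrow> y = p i"
      then have "of_int K # y = E j" using j EK by metis
      moreover have "i < j \<Longrightarrow> K \<noteq> h * int i" for i using uniq[of i] by auto
      ultimately show "\<forall>d w m c0 c1 c. d \<noteq> 0 \<and> w \<noteq> 0 \<longrightarrow>
        reaches n G H (of_int h) (of_int K) y (\<lambda>v. coded_mem Z d w m c0 c1 c v)"
        unfolding reaches_def using all[where j = j] by (intro allI impI) (elim conjE, simp)
    qed
  next
    case False
    have "\<not> (\<forall>v\<in>tuples n. G v v v \<longrightarrow> S (0 # v)) \<or> \<not> (\<forall>i. \<forall>z\<in>tuples n. \<forall>z'\<in>tuples n.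
        S (i # z) \<and> i \<noteq> of_int K \<and> H z z' \<longrightarrow> S ((i + of_int h) # z'))"
      if "d \<noteq> 0" "w \<noteq> 0" "S = coded_mem Z d w m c0 c1 c" for d w m c0 c1 c S
    proof (rule ccontr)
      assume "\<not> ?thesis"
      then have "S (E j)" for j using all[of S j] False by blast
      then have "range E \<subseteq> {v. length v = Suc n \<and> coded_mem \<int> d w m c0 c1 c v}"
        using lenE that Z by auto
      then have "finite (range E)" using finite_coded[OF that(1,2)] finite_subset by blast
      then show False using injE finite_imageD by blast
    qed
    then show ?thesis using False unfolding reaches_def by blast
  qed
qed

text \<open>Turns the graph into an algebraic group, with products chosen by totality, so that the
  library of integer powers applies.\<close>

lemma group_relE:
  fixes A :: "'a list \<Rightarrow> bool"
  assumes "group_rel n A G"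
  obtains M :: "'a list monoid" where "comm_group M" "carrier M = {x \<in> tuples n. A x}"
    "\<And>x y z. x \<in> tuples n \<Longrightarrow> y \<in> tuples n \<Longrightarrow> z \<in> tuples n \<Longrightarrow>
      G x y z \<longleftrightarrow> x \<in> carrier M \<and> y \<in> carrier M \<and> z = x \<otimes>\<^bsub>M\<^esub> y"
proof -
  note p1 = assms[unfolded group_rel_def]
  note p2 = p1[THEN conjunct2]
  note p3 = p2[THEN conjunct2]
  note p4 = p3[THEN conjunct2]
  note p5 = p4[THEN conjunct2]
  note p6 = p5[THEN conjunct2]
  have dom: "A x \<and> A y \<and> A z" if "x \<in> tuples n" "y \<in> tuples n" "z \<in> tuples n" "G x y z" for x y z
    using p1[THEN conjunct1] that by blast
  have ex: "\<exists>z\<in>tuples n. G x y z" if "x \<in> tuples n" "y \<in> tuples n" "A x" "A y" for x y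
    using p2[THEN conjunct1] that by blast
  have uniq: "z = w" if "x \<in> tuples n" "y \<in> tuples n" "z \<in> tuples n" "w \<in> tuples n" "G x y z" "G x y w" for x y z w
    using p3[THEN conjunct1] that by blast
  have comm: "G y x z" if "x \<in> tuples n" "y \<in> tuples n" "z \<in> tuples n" "G x y z" for x y z
    using p4[THEN conjunct1] that by blast
  have assoc: "G x s t" if "x \<in> tuples n" "y \<in> tuples n" "z \<in> tuples n" "r \<in> tuples n" "s \<in> tuples n" "t \<in> tuples n"
      "G x y r" "G r z t" "G y z s" for x y z r s t
    using p5[THEN conjunct1] that by blast
  from p6 obtain u where u: "u \<in> tuples n" "A u"
      "\<forall>x\<in>tuples n. A x \<longrightarrow> G u x x \<and> (\<exists>y\<in>tuples n. G y x u)"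
    by (elim bexE conjE)
  define f where "f x y = (SOME z. z \<in> tuples n \<and> G x y z)" for x y
  have f: "f x y \<in> tuples n" "G x y (f x y)" if "x \<in> tuples n" "y \<in> tuples n" "A x" "A y" for x y
  proof -
    have "\<exists>z. z \<in> tuples n \<and> G x y z" using ex[OF that] by blast
    from someI_ex[OF this] show "f x y \<in> tuples n" "G x y (f x y)" unfolding f_def by auto
  qed
  define M where "M = \<lparr>carrier = {x \<in> tuples n. A x}, mult = f, one = u\<rparr>"
  have iff: "G x y z \<longleftrightarrow> x \<in> carrier M \<and> y \<in> carrier M \<and> z = x \<otimes>\<^bsub>M\<^esub> y"
    if "x \<in> tuples n" "y \<in> tuples n" "z \<in> tuples n" for x y z
  proof
    assume *: "G x y z"
    have "A x \<and> A y \<and> A z" by (rule dom[OF that *])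
    then have "z = f x y" using uniq[OF that(1,2,3) f(1) *] f that by blast
    then show "x \<in> carrier M \<and> y \<in> carrier M \<and> z = x \<otimes>\<^bsub>M\<^esub> y"
      using \<open>A x \<and> A y \<and> A z\<close> that by (simp add: M_def)
  next
    assume "x \<in> carrier M \<and> y \<in> carrier M \<and> z = x \<otimes>\<^bsub>M\<^esub> y"
    then show "G x y z" using f(2)[of x y] by (simp add: M_def)
  qed
  have closed: "x \<otimes>\<^bsub>M\<^esub> y \<in> carrier M" if "x \<in> carrier M" "y \<in> carrier M" for x y
  proof -
    have t: "x \<in> tuples n" "y \<in> tuples n" "A x" "A y" using that by (auto simp: M_def)
    show ?thesis using f[OF t] dom[OF t(1,2) f[OF t]] by (simp add: M_def)
  qed
  have car: "x \<in> tuples n" "A x" if "x \<in> carrier M" for x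
    using that by (auto simp: M_def)
  have "comm_group M"
  proof (rule comm_groupI)
    fix x y z assume x: "x \<in> carrier M" and y: "y \<in> carrier M" and z: "z \<in> carrier M"
    note t = x y z closed[OF x y] closed[OF y z] closed[OF closed[OF x y] z]
    note t' = t[THEN car(1)]
    have "G x (y \<otimes>\<^bsub>M\<^esub> z) (x \<otimes>\<^bsub>M\<^esub> y \<otimes>\<^bsub>M\<^esub> z)"
      using assoc[OF t'(1-6)] iff t t' by simp
    then show "x \<otimes>\<^bsub>M\<^esub> y \<otimes>\<^bsub>M\<^esub> z = x \<otimes>\<^bsub>M\<^esub> (y \<otimes>\<^bsub>M\<^esub> z)"
      using iff[OF t'(1,5,6)] by simp
  next
    fix x y assume x: "x \<in> carrier M" and y: "y \<in> carrier M"
    note t = x[THEN car(1)] y[THEN car(1)] closed[OF x y, THEN car(1)]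
    have "G y x (x \<otimes>\<^bsub>M\<^esub> y)"
      by (rule comm[OF t]) (simp add: iff[OF t] x y)
    then show "x \<otimes>\<^bsub>M\<^esub> y = y \<otimes>\<^bsub>M\<^esub> x"
      by (simp add: iff[OF t(2,1,3)])
  next
    fix x assume x: "x \<in> carrier M"
    have one: "\<one>\<^bsub>M\<^esub> = u" by (simp add: M_def)
    have "G u x x" using u(3) car x by blast
    then show "\<one>\<^bsub>M\<^esub> \<otimes>\<^bsub>M\<^esub> x = x"
      using iff[OF u(1) car(1)[OF x] car(1)[OF x]] unfolding one by simp
    obtain y where y: "y \<in> tuples n" "G y x u" using u(3) car x by blast
    then show "\<exists>y\<in>carrier M. y \<otimes>\<^bsub>M\<^esub> x = \<one>\<^bsub>M\<^esub>"
      using iff[OF y(1) car(1)[OF x] u(1)] unfolding one by auto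
  next
    show "\<one>\<^bsub>M\<^esub> \<in> carrier M" using u by (simp add: M_def)
  qed (rule closed)
  moreover have "carrier M = {x \<in> tuples n. A x}" by (simp add: M_def)
  ultimately show ?thesis by (rule that) (rule iff)
qed

text \<open>\<open>reaches_iff\<close> is applied to the powers of \<open>x\<close> for the forward
  clause and to the powers of its inverse for the backward one.\<close>

lemma multiple_rel_iff:
  fixes M :: "rat list monoid"
  assumes "comm_group M" and car: "carrier M \<subseteq> tuples n"
    and G: "\<And>x y z. x \<in> tuples n \<Longrightarrow> y \<in> tuples n \<Longrightarrow> z \<in> tuples n \<Longrightarrow>
      G x y z \<longleftrightarrow> x \<in> carrier M \<and> y \<in> carrier M \<and> z = x \<otimes>\<^bsub>M\<^esub> y"
    and x: "x \<in> carrier M" and y: "y \<in> tuples n"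
  shows "multiple_rel n \<int> G (of_int K) x y \<longleftrightarrow> y = x [^]\<^bsub>M\<^esub> K"
proof -
  interpret comm_group M by fact
  have one: "G v v v \<longleftrightarrow> v = \<one>\<^bsub>M\<^esub>" if "v \<in> tuples n" for v
    using G[OF that that that] r_cancel_one by (metis one_closed r_one)
  have forward: "(\<forall>d w m c0 c1 c. d \<noteq> 0 \<and> w \<noteq> 0 \<longrightarrow>
        reaches n G (\<lambda>z z'. G z x z') (of_int 1) (of_int K) y (\<lambda>v. coded_mem \<int> d w m c0 c1 c v)) \<longleftrightarrow>
      (\<forall>j. K = 1 * int j \<longrightarrow> y = x [^]\<^bsub>M\<^esub> j)"
  proof (rule reaches_iff)
    show "G (x [^]\<^bsub>M\<^esub> j) x z \<longleftrightarrow> z = x [^]\<^bsub>M\<^esub> Suc j" if "z \<in> tuples n" for j :: nat and z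
      using G[of "x [^]\<^bsub>M\<^esub> j" x z] that x car by auto
  qed (use one x y car in auto)
  have backward: "(\<forall>d w m c0 c1 c. d \<noteq> 0 \<and> w \<noteq> 0 \<longrightarrow>
        reaches n G (\<lambda>z z'. G z' x z) (of_int (-1)) (of_int K) y (\<lambda>v. coded_mem \<int> d w m c0 c1 c v)) \<longleftrightarrow>
      (\<forall>j. K = -1 * int j \<longrightarrow> y = (inv\<^bsub>M\<^esub> x) [^]\<^bsub>M\<^esub> j)"
  proof (rule reaches_iff)
    show "G z x ((inv\<^bsub>M\<^esub> x) [^]\<^bsub>M\<^esub> j) \<longleftrightarrow> z = (inv\<^bsub>M\<^esub> x) [^]\<^bsub>M\<^esub> Suc j" if "z \<in> tuples n" for j :: nat and z
    proof -
      have cl: "(inv\<^bsub>M\<^esub> x) [^]\<^bsub>M\<^esub> j \<in> carrier M" using x by simp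
      then have "G z x ((inv\<^bsub>M\<^esub> x) [^]\<^bsub>M\<^esub> j) \<longleftrightarrow> z \<in> carrier M \<and> (inv\<^bsub>M\<^esub> x) [^]\<^bsub>M\<^esub> j = z \<otimes>\<^bsub>M\<^esub> x"
        using G[of z x "(inv\<^bsub>M\<^esub> x) [^]\<^bsub>M\<^esub> j"] that x car by blast
      also have "\<dots> \<longleftrightarrow> z = (inv\<^bsub>M\<^esub> x) [^]\<^bsub>M\<^esub> j \<otimes>\<^bsub>M\<^esub> inv\<^bsub>M\<^esub> x"
        using inv_solve_right[of z "(inv\<^bsub>M\<^esub> x) [^]\<^bsub>M\<^esub> j" x] x cl by auto
      finally show ?thesis by simp
    qed
  qed (use one x y car in auto)
  have "multiple_rel n \<int> G (of_int K) x y \<longleftrightarrow>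
      (\<forall>j. K = int j \<longrightarrow> y = x [^]\<^bsub>M\<^esub> j) \<and> (\<forall>j. K = - int j \<longrightarrow> y = (inv\<^bsub>M\<^esub> x) [^]\<^bsub>M\<^esub> j)"
    unfolding forward[unfolded of_int_1 mult_1_left, symmetric]
      backward[unfolded of_int_minus of_int_1 mult_minus_left mult_1_left, symmetric] multiple_rel_def
    by blast
  also have "\<dots> \<longleftrightarrow> y = x [^]\<^bsub>M\<^esub> K"
  proof (cases K rule: int_cases2)
    case (nonneg j)
    \<comment> \<open>Forward and backward indices meet only at zero, where both powers are the unit
      and the two clauses agree.\<close>
    have "y = (inv\<^bsub>M\<^esub> x) [^]\<^bsub>M\<^esub> i" if "int j = - int i" "y = x [^]\<^bsub>M\<^esub> j" for i
    proof -
      have "i = 0" "j = 0" using that(1) by linarith+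
      then show ?thesis using that(2) by simp
    qed
    then show ?thesis unfolding nonneg int_pow_int of_nat_eq_iff by blast
  next
    case (nonpos j)
    have "y = x [^]\<^bsub>M\<^esub> i" if "- int j = int i" "y = (inv\<^bsub>M\<^esub> x) [^]\<^bsub>M\<^esub> j" for i
    proof -
      have "i = 0" "j = 0" using that(1) by linarith+
      then show ?thesis using that(2) by simp
    qed
    then show ?thesis
      unfolding nonpos int_pow_neg_int[OF x] nat_pow_inv[OF x, symmetric] neg_equal_iff_equal of_nat_eq_iff
      by blast
  qed
  finally show ?thesis .
qed

text \<open>After identifying multiples with powers, the module axioms are the laws of integer
  exponents in an abelian group.\<close>

lemma module_rel_rat:
  fixes A :: "rat list \<Rightarrow> bool"
  assumes "group_rel n A G"
  shows "module_rel n \<int> A G (multiple_rel n \<int> G)"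
  using assms
proof (rule group_relE)
  fix M :: "rat list monoid"
  assume M: "comm_group M" "carrier M = {x \<in> tuples n. A x}"
    and G: "\<And>x y z. x \<in> tuples n \<Longrightarrow> y \<in> tuples n \<Longrightarrow> z \<in> tuples n \<Longrightarrow>
      G x y z \<longleftrightarrow> x \<in> carrier M \<and> y \<in> carrier M \<and> z = x \<otimes>\<^bsub>M\<^esub> y"
  interpret comm_group M by fact
  have car: "carrier M \<subseteq> tuples n" using M by auto
  have A: "A x \<longleftrightarrow> x \<in> carrier M" if "x \<in> tuples n" for x using M that by auto
  have mul: "multiple_rel n \<int> G (of_int k) x y \<longleftrightarrow> y = x [^]\<^bsub>M\<^esub> k"
    if "x \<in> carrier M" "y \<in> tuples n" for k x y
    by (rule multiple_rel_iff[OF M(1) car G that])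
  show ?thesis
    unfolding module_rel_def
  proof (intro conjI allI ballI impI; (elim conjE)?; (elim Ints_cases)?)
    fix r :: rat and x and k :: int assume x: "x \<in> tuples n" "A x" and k: "r = of_int k"
    have x': "x \<in> carrier M" using x A by simp
    show "\<exists>y\<in>tuples n. A y \<and> multiple_rel n \<int> G r x y \<and>
        (\<forall>z\<in>tuples n. A z \<and> multiple_rel n \<int> G r x z \<longrightarrow> z = y)"
    proof (intro bexI conjI ballI impI)
      show y: "x [^]\<^bsub>M\<^esub> k \<in> tuples n" using x' car by auto
      show "A (x [^]\<^bsub>M\<^esub> k)" using A[OF y] x' by simp
      show "multiple_rel n \<int> G r x (x [^]\<^bsub>M\<^esub> k)" using mul[OF x' y] unfolding k by simp
      show "z = x [^]\<^bsub>M\<^esub> k" if "z \<in> tuples n" "A z \<and> multiple_rel n \<int> G r x z" for z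
        using mul[OF x' that(1)] that unfolding k by simp
    qed
  next
    fix r s :: rat and x y z w and k l :: int
    assume t: "x \<in> tuples n" "y \<in> tuples n" "z \<in> tuples n" "w \<in> tuples n" "A x" "A y" "A z" "A w"
      and m: "multiple_rel n \<int> G r x y" "multiple_rel n \<int> G s x z" "multiple_rel n \<int> G (r + s) x w"
      and k: "r = of_int k" "s = of_int l"
    have x': "x \<in> carrier M" using t A by simp
    have "y = x [^]\<^bsub>M\<^esub> k" using m(1) mul[OF x' t(2)] unfolding k by simp
    moreover have "z = x [^]\<^bsub>M\<^esub> l" using m(2) mul[OF x' t(3)] unfolding k by simp
    moreover have "w = x [^]\<^bsub>M\<^esub> (k + l)"
      using m(3) mul[OF x' t(4)] unfolding k of_int_add[symmetric] by blast
    ultimately show "G y z w" using G[OF t(2-4)] x' int_pow_mult by simp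
  next
    fix r :: rat and x x' x'' y y' y'' and k :: int
    assume t: "x \<in> tuples n" "x' \<in> tuples n" "x'' \<in> tuples n" "y \<in> tuples n" "y' \<in> tuples n" "y'' \<in> tuples n"
      and g: "G x x' x''"
      and m: "multiple_rel n \<int> G r x y" "multiple_rel n \<int> G r x' y'" "multiple_rel n \<int> G r x'' y''"
      and k: "r = of_int k"
    have x: "x \<in> carrier M" "x' \<in> carrier M" "x'' = x \<otimes>\<^bsub>M\<^esub> x'" using g G[OF t(1-3)] by blast+
    then have x'': "x'' \<in> carrier M" by simp
    have "y = x [^]\<^bsub>M\<^esub> k" using m(1) mul[OF x(1) t(4)] unfolding k by simp
    moreover have "y' = x' [^]\<^bsub>M\<^esub> k" using m(2) mul[OF x(2) t(5)] unfolding k by simp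
    moreover have "y'' = x'' [^]\<^bsub>M\<^esub> k" using m(3) mul[OF x'' t(6)] unfolding k by simp
    ultimately show "G y y' y''" using G[OF t(4-6)] x int_pow_distrib by simp
  next
    fix r s :: rat and x y z and k l :: int
    assume t: "x \<in> tuples n" "y \<in> tuples n" "z \<in> tuples n" "A x" "A y" "A z"
      and m: "multiple_rel n \<int> G s x y" "multiple_rel n \<int> G r y z"
      and k: "r = of_int k" "s = of_int l"
    have x': "x \<in> carrier M" "y \<in> carrier M" using t A by simp_all
    have "y = x [^]\<^bsub>M\<^esub> l" using m(1) mul[OF x'(1) t(2)] unfolding k by simp
    moreover have "z = y [^]\<^bsub>M\<^esub> k" using m(2) mul[OF x'(2) t(3)] unfolding k by simp
    ultimately have "z = x [^]\<^bsub>M\<^esub> (k * l)" using x' by (simp add: int_pow_pow mult.commute)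
    then show "multiple_rel n \<int> G (r * s) x z"
      using mul[OF x'(1) t(3)] unfolding k of_int_mult[symmetric] by blast
  next
    fix x assume x: "x \<in> tuples n" "A x"
    then have "x \<in> carrier M" using A by simp
    then show "multiple_rel n \<int> G 1 x x" using mul[OF _ x(1), of x 1] by simp
  qed simp_all
qed

section \<open>From relations back to module structures\<close>

lemma group_relI:
  assumes "comm_group M" and car: "carrier M \<subseteq> tuples n"
    and A: "\<And>x. x \<in> tuples n \<Longrightarrow> A x \<longleftrightarrow> x \<in> carrier M"
    and G: "\<And>x y z. x \<in> tuples n \<Longrightarrow> y \<in> tuples n \<Longrightarrow> z \<in> tuples n \<Longrightarrow>
      G x y z \<longleftrightarrow> x \<in> carrier M \<and> y \<in> carrier M \<and> z = x \<otimes>\<^bsub>M\<^esub> y"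
  shows "group_rel n A G"
proof -
  interpret comm_group M by fact
  have mem: "x \<in> tuples n" if "x \<in> carrier M" for x using that car by blast
  show ?thesis
    unfolding group_rel_def
  proof (intro conjI ballI impI)
    fix x y assume t: "x \<in> tuples n" "y \<in> tuples n" "A x \<and> A y"
    then have "x \<otimes>\<^bsub>M\<^esub> y \<in> carrier M" "x \<in> carrier M" "y \<in> carrier M" using A by auto
    then show "\<exists>z\<in>tuples n. G x y z" using G[OF t(1,2) mem] mem by blast
  next
    show "\<exists>u\<in>tuples n. A u \<and> (\<forall>x\<in>tuples n. A x \<longrightarrow> G u x x \<and> (\<exists>y\<in>tuples n. G y x u))"
    proof (rule bexI[of _ "\<one>\<^bsub>M\<^esub>"], intro conjI ballI impI)
      show one: "\<one>\<^bsub>M\<^esub> \<in> tuples n" by (simp add: mem)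
      show "A \<one>\<^bsub>M\<^esub>" using A[OF one] by simp
      fix x assume t: "x \<in> tuples n" and "A x"
      then have x: "x \<in> carrier M" using A by simp
      then show "G \<one>\<^bsub>M\<^esub> x x" using G[OF one t t] by simp
      have "inv\<^bsub>M\<^esub> x \<in> tuples n" using x mem by simp
      then show "\<exists>y\<in>tuples n. G y x \<one>\<^bsub>M\<^esub>" using G[OF _ t one] x by (intro bexI[of _ "inv\<^bsub>M\<^esub> x"]) simp_all
    qed
  next
    fix x y z assume t: "x \<in> tuples n" "y \<in> tuples n" "z \<in> tuples n" "G x y z"
    then have g: "x \<in> carrier M" "y \<in> carrier M" "z = x \<otimes>\<^bsub>M\<^esub> y" using G by blast+
    then show "A x" "A y" "A z" using A t by simp_all
    show "G y x z" using G[OF t(2,1,3)] g m_comm by simp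
  next
    fix x y z r assume t: "x \<in> tuples n" "y \<in> tuples n" "z \<in> tuples n" "r \<in> tuples n" "G x y z \<and> G x y r"
    then show "z = r" using G[of x y z] G[of x y r] by simp
  next
    fix x y z r s t
    assume t: "x \<in> tuples n" "y \<in> tuples n" "z \<in> tuples n" "r \<in> tuples n" "s \<in> tuples n" "t \<in> tuples n"
      and g: "G x y r \<and> G r z t \<and> G y z s"
    have "x \<in> carrier M" "y \<in> carrier M" "z \<in> carrier M"
      "r = x \<otimes>\<^bsub>M\<^esub> y" "t = r \<otimes>\<^bsub>M\<^esub> z" "s = y \<otimes>\<^bsub>M\<^esub> z"
      using g G[OF t(1,2,4)] G[OF t(4,3,6)] G[OF t(2,3,5)] by blast+
    then show "G x s t" using G[OF t(1,5,6)] by (simp add: m_assoc)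
  qed
qed

text \<open>Scalar multiples are chosen from \<open>R\<close>; uniqueness of the values turns each
  relational law into an equation for \<open>sm\<close>.\<close>

lemma starZ_module_ext_of_module_rel:
  fixes M :: "'a::comm_ring_1 list monoid"
  assumes "comm_group M" and car: "carrier M \<subseteq> tuples n"
    and A: "\<And>x. x \<in> tuples n \<Longrightarrow> A x \<longleftrightarrow> x \<in> carrier M"
    and G: "\<And>x y z. x \<in> tuples n \<Longrightarrow> y \<in> tuples n \<Longrightarrow> z \<in> tuples n \<Longrightarrow>
      G x y z \<longleftrightarrow> x \<in> carrier M \<and> y \<in> carrier M \<and> z = x \<otimes>\<^bsub>M\<^esub> y"
    and R: "module_rel n Z A G R"
  shows "\<exists>sm. starZ_module_ext M Z sm"
proof -
  interpret comm_group M by fact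
  have mem: "x \<in> tuples n" if "x \<in> carrier M" for x using that car by blast
  note R1 = R[unfolded module_rel_def]
  note R2 = R1[THEN conjunct2]
  note R3 = R2[THEN conjunct2]
  note R4 = R3[THEN conjunct2]
  note R5 = R4[THEN conjunct2]
  note R6 = R5[THEN conjunct2]
  note R7 = R6[THEN conjunct2]
  note one = R1[THEN conjunct1]
  have closed: "r + s \<in> Z" "r - s \<in> Z" "r * s \<in> Z" if "r \<in> Z" "s \<in> Z" for r s
    using R2[THEN conjunct1] that by blast+
  define sm where "sm r x = (SOME y. y \<in> tuples n \<and> A y \<and> R r x y)" for r x
  have ex: "\<exists>y\<in>tuples n. A y \<and> R r x y \<and> (\<forall>z\<in>tuples n. A z \<and> R r x z \<longrightarrow> z = y)"
    if "r \<in> Z" "x \<in> carrier M" for r x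
    using R3[THEN conjunct1] that mem A by blast
  have sm: "sm r x \<in> tuples n" "A (sm r x)" "R r x (sm r x)" if "r \<in> Z" "x \<in> carrier M" for r x
  proof -
    have "\<exists>y. y \<in> tuples n \<and> A y \<and> R r x y" using ex[OF that] by blast
    from someI_ex[OF this] show "sm r x \<in> tuples n" "A (sm r x)" "R r x (sm r x)"
      unfolding sm_def by blast+
  qed
  have car_sm: "sm r x \<in> carrier M" if "r \<in> Z" "x \<in> carrier M" for r x
    using sm[OF that] A by blast
  have uniq: "z = sm r x" if "r \<in> Z" "x \<in> carrier M" "z \<in> carrier M" "R r x z" for r x z
  proof -
    have "z \<in> tuples n" "A z" using that mem A by blast+
    then show ?thesis using ex[OF that(1,2)] sm[OF that(1,2)] that(4) by metis
  qed
  have add: "sm (r + s) x = sm r x \<otimes>\<^bsub>M\<^esub> sm s x" if "r \<in> Z" "s \<in> Z" "x \<in> carrier M" for r s x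
  proof -
    note rs = closed(1)[OF that(1,2)]
    have "A x" using that mem A by blast
    then have "G (sm r x) (sm s x) (sm (r + s) x)"
      using R4[THEN conjunct1] that(1,2) mem[OF that(3)] sm[OF that(1,3)] sm[OF that(2,3)] sm[OF rs that(3)]
      by blast
    then show ?thesis using G sm[OF that(1,3)] sm[OF that(2,3)] sm[OF rs that(3)] by blast
  qed
  have distrib: "sm r (x \<otimes>\<^bsub>M\<^esub> y) = sm r x \<otimes>\<^bsub>M\<^esub> sm r y"
    if "r \<in> Z" "x \<in> carrier M" "y \<in> carrier M" for r x y
  proof -
    have xy: "x \<otimes>\<^bsub>M\<^esub> y \<in> carrier M" using that by simp
    have "G x y (x \<otimes>\<^bsub>M\<^esub> y)" using G[OF mem mem mem] that xy by blast
    then have "G (sm r x) (sm r y) (sm r (x \<otimes>\<^bsub>M\<^esub> y))"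
      using R5[THEN conjunct1] that(1) mem[OF that(2)] mem[OF that(3)] mem[OF xy]
        sm[OF that(1,2)] sm[OF that(1,3)] sm[OF that(1) xy]
      by blast
    then show ?thesis using G sm[OF that(1,2)] sm[OF that(1,3)] sm[OF that(1) xy] by blast
  qed
  have mult: "sm (r * s) x = sm r (sm s x)" if "r \<in> Z" "s \<in> Z" "x \<in> carrier M" for r s x
  proof -
    note c = car_sm[OF that(2,3)]
    have "A x" using that mem A by blast
    then have "R (r * s) x (sm r (sm s x))"
      using R6[THEN conjunct1] that(1,2) mem[OF that(3)] sm[OF that(2,3)] sm[OF that(1) c] by blast
    then show ?thesis using uniq[OF closed(3)[OF that(1,2)] that(3) car_sm[OF that(1) c]] by simp
  qed
  have sm_one: "sm 1 x = x" if "x \<in> carrier M" for x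
  proof -
    have "R 1 x x" using R7 that mem A by blast
    then show ?thesis using uniq[OF one that that] by simp
  qed
  have zero: "0 \<in> Z" using closed(2)[OF one one] by simp
  \<comment> \<open>By \<open>0 + 0 = 0\<close>, the element \<open>sm 0 x\<close> is idempotent in
    a group.\<close>
  have sm_zero: "sm 0 x = \<one>\<^bsub>M\<^esub>" if "x \<in> carrier M" for x
    using add[OF zero zero that] car_sm[OF zero that] by (metis add_0 r_cancel_one)
  have nat: "of_nat k \<in> Z" for k
    by (induction k) (simp_all add: zero one closed)
  have sm_nat: "sm (of_nat k) x = x [^]\<^bsub>M\<^esub> k" if "x \<in> carrier M" for k x
  proof (induction k)
    case 0
    then show ?case using sm_zero[OF that] by simp
  next
    case (Suc k)
    have "sm (of_nat k + 1) x = sm (of_nat k) x \<otimes>\<^bsub>M\<^esub> sm 1 x" using add[OF nat one that] .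
    then show ?case using Suc sm_one[OF that] by (simp add: add.commute)
  qed
  have neg: "- of_nat k \<in> Z" for k
    using closed(2)[OF zero nat] by simp
  have sm_neg: "sm (- of_nat k) x = x [^]\<^bsub>M\<^esub> (- int k)" if "x \<in> carrier M" for k x
  proof -
    have "sm (- of_nat k) x \<otimes>\<^bsub>M\<^esub> sm (of_nat k) x = \<one>\<^bsub>M\<^esub>"
      using add[OF neg[of k] nat[of k] that] sm_zero[OF that] by simp
    then have "sm (- of_nat k) x = inv\<^bsub>M\<^esub> (sm (of_nat k) x)"
      using car_sm[OF neg that] car_sm[OF nat that] inv_equality by metis
    then show ?thesis using sm_nat[OF that] that by (simp add: int_pow_neg_int)
  qed
  have sm_int: "sm (of_int k) x = x [^]\<^bsub>M\<^esub> k" if "x \<in> carrier M" for k :: int and x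
  proof (cases k rule: int_cases2)
    case (nonneg j)
    then show ?thesis using sm_nat[OF that] by (simp add: int_pow_int)
  next
    case (nonpos j)
    then show ?thesis using sm_neg[OF that] by simp
  qed
  have "starZ_module_ext M Z sm"
    unfolding starZ_module_ext_def
    by (intro conjI ballI allI car_sm add distrib mult sm_one sm_int)
  then show ?thesis by blast
qed

section \<open>Nonstandard integers and definable groups\<close>

text \<open>Characteristic zero transfers, one sentence for each positive natural number.\<close>

lemma of_int_inj_of_ThQ:
  assumes "ThQ_model TYPE('a::comm_ring_1)"
  shows "inj (of_int :: int \<Rightarrow> 'a)"
proof (rule injI)
  have nz: "of_nat (Suc k) \<noteq> (0::'a)" for k
  proof (rule ThQ_transfer[OF assms, where Q = "\<lambda>e. of_nat (Suc k) \<noteq> (0::'a)"])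
    show "codef (\<lambda>e::nat \<Rightarrow> rat. of_nat (Suc k) \<noteq> (0::rat)) (\<lambda>e::nat \<Rightarrow> 'a. of_nat (Suc k) \<noteq> (0::'a))"
      by (intro codef_not codef_eq cterm_of_nat cterm_zero)
  qed (simp del: of_nat_Suc)
  have *: "k = m" if "m \<le> k" "of_int k = (of_int m :: 'a)" for k m :: int
  proof (rule ccontr)
    assume "k \<noteq> m"
    then have "0 < k - m" using that(1) by simp
    then obtain j where "k - m = int (Suc j)"
      using zero_less_imp_eq_int gr0_implies_Suc by blast
    then have "of_int (k - m) = (of_nat (Suc j) :: 'a)" by (simp del: of_nat_Suc of_int_diff)
    then show False using nz[of j] that(2) by (simp del: of_nat_Suc)
  qed
  fix k m :: int assume "of_int k = (of_int m :: 'a)"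
  then show "k = m" using *[of m k] *[of k m] by (cases "m \<le> k") auto
qed

text \<open>Two formulas defining the integers in the rationals are equivalent there, and this
  equivalence is a sentence that transfers.\<close>

lemma starZ_eq:
  assumes T: "ThQ_model TYPE('a::comm_ring_1)"
    and \<zeta>: "fvf \<zeta> \<subseteq> {0}" "\<forall>q::rat. rsat (\<lambda>_. q) \<zeta> \<longleftrightarrow> q \<in> \<int>"
  shows "starZ TYPE('a) = zset \<zeta>"
proof -
  have "a \<in> zset \<zeta>" if "fvf \<phi> \<subseteq> {0}" "\<forall>q::rat. rsat (\<lambda>_. q) \<phi> \<longleftrightarrow> q \<in> \<int>" "rsat (\<lambda>_. a) \<phi>" for \<phi> and a :: 'a
  proof -
    have "(\<lambda>e::nat \<Rightarrow> 'a. \<forall>x::'a. x \<in> zset \<phi> \<longleftrightarrow> x \<in> zset \<zeta>) undefined"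
    proof (rule ThQ_transfer[OF T])
      show "codef (\<lambda>e::nat \<Rightarrow> rat. \<forall>x::rat. x \<in> zset \<phi> \<longleftrightarrow> x \<in> zset \<zeta>) (\<lambda>e::nat \<Rightarrow> 'a. \<forall>x::'a. x \<in> zset \<phi> \<longleftrightarrow> x \<in> zset \<zeta>)"
        by (intro codef_intros)
    qed (use that \<zeta> in \<open>simp add: zset_def\<close>)
    then show ?thesis using that(3) by (auto simp: zset_def)
  qed
  then show ?thesis using \<zeta> unfolding starZ_def by (auto simp: zset_def)
qed

text \<open>Without scalars only the clauses for \<open>1\<close> and \<open>of_int n\<close> say
  anything; injectivity lets the exponent be read back from its image.\<close>

lemma starZ_module_ext_empty:
  assumes "comm_group M" "inj (of_int :: int \<Rightarrow> 'a::comm_ring_1)"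
  shows "\<exists>sm. starZ_module_ext M ({} :: 'a set) sm"
proof -
  interpret comm_group M by fact
  have inv: "inv_into UNIV of_int (of_int k :: 'a) = k" for k using assms(2) by (rule inv_f_f)
  show ?thesis
    unfolding starZ_module_ext_def
    using inv inv[of 1] unfolding of_int_1 by (intro exI[of _ "\<lambda>r a. a [^]\<^bsub>M\<^esub> (inv_into UNIV of_int r :: int)"]) simp
qed

lemma definable_group_starZ_module:
  fixes T :: "'a::comm_ring_1 itself" and A :: "'a list set"
  assumes T: "ThQ_model T" and A: "definable_group n A f u"
  shows "\<exists>sm. starZ_module_ext \<lparr>carrier = A, mult = f, one = u\<rparr> (starZ T) sm"
proof -
  have T': "ThQ_model TYPE('a)" "starZ T = starZ TYPE('a)"
    using T unfolding ThQ_model_def starZ_def by blast+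
  define M where "M = \<lparr>carrier = A, mult = f, one = u\<rparr>"
  have M: "comm_group M" and car: "carrier M \<subseteq> tuples n"
    using A unfolding M_def definable_group_def tuples_def by simp_all
  interpret comm_group M by fact
  show ?thesis
  proof (cases "starZ T = {}")
    case True
    then show ?thesis using starZ_module_ext_empty[OF M of_int_inj_of_ThQ[OF T'(1)]] by (simp add: M_def)
  next
    case False
    then obtain \<zeta> where \<zeta>: "fvf \<zeta> \<subseteq> {0}" "\<forall>q::rat. rsat (\<lambda>_. q) \<zeta> \<longleftrightarrow> q \<in> \<int>"
      unfolding starZ_def by blast
    obtain \<phi> e1 where \<phi>: "A = {xs. length xs = n \<and> rsat (env xs e1) \<phi>}"
      using A unfolding definable_group_def definable_def by blast
    obtain \<psi> e2 where \<psi>: "{xs @ ys @ f xs ys | xs ys. xs \<in> A \<and> ys \<in> A} =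
        {xs. length xs = 3 * n \<and> rsat (env xs e2) \<psi>}"
      using A unfolding definable_group_def definable_def by blast
    define e where "e i = (if even i then e1 (i div 2) else e2 (i div 2))" for i
    define A' where "A' x = rsat (env x (\<lambda>i. e (2 * i))) \<phi>" for x
    define G where "G x y z = rsat (env (x @ y @ z) (\<lambda>i. e (2 * i + 1))) \<psi>" for x y z
    have e: "(\<lambda>i. e (2 * i)) = e1" "(\<lambda>i. e (2 * i + 1)) = e2" by (auto simp: e_def)
    have A'_iff: "A' x \<longleftrightarrow> x \<in> carrier M" if "x \<in> tuples n" for x
      using that unfolding A'_def e by (simp add: M_def \<phi> tuples_def)
    have G_iff: "G x y z \<longleftrightarrow> x \<in> carrier M \<and> y \<in> carrier M \<and> z = x \<otimes>\<^bsub>M\<^esub> y"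
      if "x \<in> tuples n" "y \<in> tuples n" "z \<in> tuples n" for x y z
    proof -
      have "G x y z \<longleftrightarrow> x @ y @ z \<in> {xs @ ys @ f xs ys | xs ys. xs \<in> A \<and> ys \<in> A}"
        unfolding \<psi> G_def e using that by (simp add: tuples_def)
      also have "\<dots> \<longleftrightarrow> x \<in> A \<and> y \<in> A \<and> z = f x y"
      proof
        assume "x @ y @ z \<in> {xs @ ys @ f xs ys | xs ys. xs \<in> A \<and> ys \<in> A}"
        then obtain xs ys where xs: "x @ y @ z = xs @ ys @ f xs ys" "xs \<in> A" "ys \<in> A" by blast
        \<comment> \<open>Known block lengths make the concatenation split uniquely.\<close>
        then have "length xs = n" "length ys = n" using car by (auto simp: tuples_def M_def)
        then show "x \<in> A \<and> y \<in> A \<and> z = f x y" using xs that by (simp add: tuples_def)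
      qed blast
      finally show ?thesis by (simp add: M_def)
    qed
    have "group_rel n A' G" by (rule group_relI[OF M car A'_iff G_iff])
    moreover have "group_rel n A' G \<longrightarrow> module_rel n (zset \<zeta>) A' G (multiple_rel n (zset \<zeta>) G)"
      unfolding A'_def G_def
    proof (rule ThQ_transfer[OF T'(1) codef_group_module, where e = e])
      fix e :: "nat \<Rightarrow> rat"
      have "zset \<zeta> = (\<int> :: rat set)" using \<zeta>(2) by (auto simp: zset_def)
      then show "group_rel n (\<lambda>x. rsat (env x (\<lambda>i. e (2 * i))) \<phi>)
          (\<lambda>x y z. rsat (env (x @ y @ z) (\<lambda>i. e (2 * i + 1))) \<psi>) \<longrightarrow>
        module_rel n (zset \<zeta>) (\<lambda>x. rsat (env x (\<lambda>i. e (2 * i))) \<phi>)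
          (\<lambda>x y z. rsat (env (x @ y @ z) (\<lambda>i. e (2 * i + 1))) \<psi>)
          (multiple_rel n (zset \<zeta>) (\<lambda>x y z. rsat (env (x @ y @ z) (\<lambda>i. e (2 * i + 1))) \<psi>))"
        using module_rel_rat by simp
    qed
    ultimately have "module_rel n (starZ T) A' G (multiple_rel n (starZ T) G)"
      using starZ_eq[OF T'(1) \<zeta>] T'(2) by simp
    from starZ_module_ext_of_module_rel[OF M car A'_iff G_iff this]
    show ?thesis by (simp add: M_def)
  qed
qed

section \<open>Elliptic curves\<close>

text \<open>Besides incidence: \<open>x\<^sup>3 + a x + b - (l x + v)\<^sup>2 = (x - x1) (x - x2) (x - x3)\<close>, which covers
  tangents as well.\<close>
definition ec_line :: "'a::field \<Rightarrow> 'a \<Rightarrow> 'a \<Rightarrow> 'a \<Rightarrow> 'a \<Rightarrow> 'a \<Rightarrow> 'a \<Rightarrow> 'a \<Rightarrow> 'a \<Rightarrow> 'a \<Rightarrow> bool" where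
  "ec_line a b l v x1 y1 x2 y2 x3 y3 \<longleftrightarrow>
     y1 = l * x1 + v \<and> y2 = l * x2 + v \<and> y3 = l * x3 + v \<and>
     l ^ 2 = x1 + x2 + x3 \<and> a - 2 * l * v = x1 * x2 + x1 * x3 + x2 * x3 \<and> v ^ 2 - b = x1 * x2 * x3"

section \<open>Lines meeting the cubic in three points\<close>

lemma ec_line_swap: "ec_line a b l v x1 y1 x2 y2 x3 y3 \<Longrightarrow> ec_line a b l v x2 y2 x1 y1 x3 y3"
  unfolding ec_line_def by (auto simp: algebra_simps)

lemma ec_line_rotate: "ec_line a b l v x1 y1 x2 y2 x3 y3 \<Longrightarrow> ec_line a b l v x2 y2 x3 y3 x1 y1"
  unfolding ec_line_def by (auto simp: algebra_simps)

lemma ec_line_neg: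
  "ec_line a b l v x1 y1 x2 y2 x3 y3 \<Longrightarrow> ec_line a b (- l) (- v) x1 (- y1) x2 (- y2) x3 (- y3)"
  unfolding ec_line_def by auto

lemma ec_line_on_curve:
  "ec_line a b l v x1 y1 x2 y2 x3 y3 \<Longrightarrow> y1 ^ 2 = x1 ^ 3 + a * x1 + b"
  unfolding ec_line_def by algebra

text \<open>At a double root \<open>x1\<close>, the derivative of
  \<open>x^3 + a x + b - (l x + v)^2\<close> vanishes too.\<close>

lemma ec_line_tangent:
  "ec_line a b l v x1 y1 x1 y2 x3 y3 \<Longrightarrow> 2 * y1 * l = 3 * x1 ^ 2 + a"
  unfolding ec_line_def by algebra

text \<open>Opposite points on a non-vertical line coincide with \<open>y1 = 0\<close>. The tangent
  equation then makes \<open>x1\<close> a double root of \<open>x^3 + a x + b\<close>, against the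
  discriminant.\<close>

lemma ec_line_not_opposite:
  fixes a b :: "'a::field"
  assumes two: "(2::'a) \<noteq> 0" and disc: "4 * a ^ 3 + 27 * b ^ 2 \<noteq> 0"
    and line: "ec_line a b l v x1 y1 x2 y2 x3 y3"
  shows "\<not> (x1 = x2 \<and> y1 = - y2)"
proof
  assume opp: "x1 = x2 \<and> y1 = - y2"
  have "y1 = y2" using line opp unfolding ec_line_def by metis
  then have "2 * y1 = 0" using opp by simp
  then have "y1 = 0" using two by simp
  then have "3 * x1 ^ 2 + a = 0" "0 = x1 ^ 3 + a * x1 + b"
    using ec_line_tangent[of a b l v x1 y1 y2 x3 y3] ec_line_on_curve[OF line] line opp by auto
  then have "4 * a ^ 3 + 27 * b ^ 2 = 0" by algebra
  then show False using disc by contradiction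
qed

text \<open>The slope is fixed by the chord or, for coinciding points, by the tangent; everything
  else is determined by the slope.\<close>

lemma ec_line_unique:
  assumes L: "ec_line a b l v x1 y1 x2 y2 x3 y3" and L': "ec_line a b l' v' x1 y1 x2 y2 x3' y3'"
    and ne: "\<not> (x1 = x2 \<and> y1 = - y2)"
  shows "l' = l" "v' = v" "x3' = x3" "y3' = y3"
proof -
  show l: "l' = l"
  proof (cases "x1 = x2")
    case True
    then have "y1 = y2" using L by (simp add: ec_line_def)
    then have "2 * y1 \<noteq> 0" using ne True by (metis add_eq_0_iff mult_2)
    moreover have "2 * y1 * l = 2 * y1 * l'"
      using L L' True by (metis ec_line_tangent)
    ultimately show ?thesis by (metis mult_left_cancel)
  next
    case False
    have "l * (x1 - x2) = y1 - y2" using L unfolding ec_line_def by algebra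
    moreover have "l' * (x1 - x2) = y1 - y2" using L' unfolding ec_line_def by algebra
    ultimately have "l' * (x1 - x2) = l * (x1 - x2)" by simp
    then show ?thesis using False by simp
  qed
  show v: "v' = v" using L L' l by (auto simp: ec_line_def)
  show x: "x3' = x3" using L L' l by (auto simp: ec_line_def)
  show "y3' = y3" using L L' l v x by (auto simp: ec_line_def)
qed

lemma ec_add_line:
  fixes a b :: "'a::field"
  assumes P: "y1 ^ 2 = x1 ^ 3 + a * x1 + b" and Q: "y2 ^ 2 = x2 ^ 3 + a * x2 + b"
    and ne: "\<not> (x1 = x2 \<and> y1 = - y2)"
  shows "\<exists>l v x3 y3. ec_add a (Some (x1, y1)) (Some (x2, y2)) = Some (x3, y3) \<and>
    ec_line a b l v x1 y1 x2 y2 x3 (- y3)"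
proof -
  define l where "l = (if x1 = x2 then (3 * x1 ^ 2 + a) / (2 * y1) else (y2 - y1) / (x2 - x1))"
  define x3 where "x3 = l ^ 2 - x1 - x2"
  define y3 where "y3 = l * (x1 - x3) - y1"
  have add: "ec_add a (Some (x1, y1)) (Some (x2, y2)) = Some (x3, y3)"
    using ne by (simp add: Let_def l_def x3_def y3_def)
  \<comment> \<open>The second equation is the difference of the two curve equations divided by
    \<open>x2 - x1\<close>; at \<open>x1 = x2\<close> it is the tangent condition, so chord and
    tangent are treated alike afterwards.\<close>
  have "l * (x2 - x1) = y2 - y1 \<and> 2 * y1 * l + l ^ 2 * (x2 - x1) = x1 ^ 2 + x1 * x2 + x2 ^ 2 + a"
  proof (cases "x1 = x2")
    case True
    have "(y1 - y2) * (y1 + y2) = 0" using P Q unfolding True by algebra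
    then have "y1 = y2" using ne True by (auto simp: add_eq_0_iff2)
    then have "2 * y1 \<noteq> 0" using ne True by (metis add_eq_0_iff mult_2)
    then have "l * (2 * y1) = 3 * x1 ^ 2 + a" using True by (simp add: l_def)
    then show ?thesis using True \<open>y1 = y2\<close> by (simp add: algebra_simps power2_eq_square)
  next
    case False
    then have l: "l * (x2 - x1) = y2 - y1" by (simp add: l_def)
    have "(x2 - x1) * (2 * y1 * l + l ^ 2 * (x2 - x1)) = (x2 - x1) * (x1 ^ 2 + x1 * x2 + x2 ^ 2 + a)"
      using l P Q by algebra
    then show ?thesis using l False by simp
  qed
  then have l: "l * (x2 - x1) = y2 - y1"
    and c: "2 * y1 * l + l ^ 2 * (x2 - x1) = x1 ^ 2 + x1 * x2 + x2 ^ 2 + a" by auto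
  define v where "v = y1 - l * x1"
  have "ec_line a b l v x1 y1 x2 y2 x3 (- y3)"
    unfolding ec_line_def
  proof (intro conjI)
    show "y1 = l * x1 + v" by (simp add: v_def)
    show "y2 = l * x2 + v" using l by (simp add: v_def algebra_simps)
    show "- y3 = l * x3 + v" by (simp add: y3_def v_def algebra_simps)
    show e1: "l ^ 2 = x1 + x2 + x3" by (simp add: x3_def)
    show e2: "a - 2 * l * v = x1 * x2 + x1 * x3 + x2 * x3"
      using c e1 v_def by algebra
    show "v ^ 2 - b = x1 * x2 * x3"
      using e1 e2 P v_def by algebra
  qed
  with add show ?thesis by blast
qed

section \<open>Negation and addition in terms of lines\<close>

fun ec_neg :: "('a::field \<times> 'a) option \<Rightarrow> ('a \<times> 'a) option" where
  "ec_neg None = None"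
| "ec_neg (Some (x, y)) = Some (x, - y)"

lemma ec_neg_neg [simp]: "ec_neg (ec_neg P) = P"
  by (cases P rule: ec_neg.cases) auto

lemma ec_neg_points: "P \<in> ec_points a b \<Longrightarrow> ec_neg P \<in> ec_points a b"
  by (auto simp: ec_points_def)

lemma ec_add_None [simp]: "ec_add a P None = P"
  by (cases P) auto

locale elliptic =
  fixes a b :: "'a::field"
  assumes two: "(2::'a) \<noteq> 0" and disc: "4 * a ^ 3 + 27 * b ^ 2 \<noteq> 0"
begin

abbreviation line where "line \<equiv> ec_line a b"
abbreviation E where "E \<equiv> ec_points a b"
abbreviation add (infixl "\<oplus>" 65) where "P \<oplus> Q \<equiv> ec_add a P Q"

lemmas not_opposite = ec_line_not_opposite[OF two disc]

lemma add_eq_SomeD: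
  assumes "Some (x1, y1) \<in> E" "Some (x2, y2) \<in> E" "Some (x1, y1) \<oplus> Some (x2, y2) = Some (x3, y3)"
  shows "\<exists>l v. line l v x1 y1 x2 y2 x3 (- y3)"
proof -
  have "\<not> (x1 = x2 \<and> y1 = - y2)" using assms(3) by auto
  moreover have "y1 ^ 2 = x1 ^ 3 + a * x1 + b" "y2 ^ 2 = x2 ^ 3 + a * x2 + b"
    using assms(1,2) by (auto simp: ec_points_def)
  ultimately obtain l v x y where
      *: "Some (x1, y1) \<oplus> Some (x2, y2) = Some (x, y)" "line l v x1 y1 x2 y2 x (- y)"
    using ec_add_line[of y1 x1 a b y2 x2] by blast
  then have "x = x3" "y = y3" using assms(3) unfolding *(1) by simp_all
  then show ?thesis using *(2) by blast
qed

text \<open>The addition formulas produce some line through the two points, and by uniqueness it is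
  the given one.\<close>

lemma add_eq_SomeI:
  assumes L: "line l v x1 y1 x2 y2 x3 (- y3)"
  shows "Some (x1, y1) \<oplus> Some (x2, y2) = Some (x3, y3)"
proof -
  have ne: "\<not> (x1 = x2 \<and> y1 = - y2)" using L by (rule not_opposite)
  have c: "y1 ^ 2 = x1 ^ 3 + a * x1 + b" "y2 ^ 2 = x2 ^ 3 + a * x2 + b"
    using ec_line_on_curve[OF L] ec_line_on_curve[OF ec_line_swap[OF L]] .
  from ec_add_line[OF c ne] obtain l' v' x y
    where *: "Some (x1, y1) \<oplus> Some (x2, y2) = Some (x, y)" "line l' v' x1 y1 x2 y2 x (- y)"
    by blast
  have "x = x3" "- y = - y3" using ec_line_unique[OF L *(2) ne] by auto
  then show ?thesis using * by simp
qed

lemma add_eq_NoneD: "Some (x1, y1) \<oplus> Some (x2, y2) = None \<Longrightarrow> x2 = x1 \<and> y2 = - y1"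
  by (auto simp: Let_def split: if_splits)

lemma add_neg [simp]: "P \<oplus> ec_neg P = None"
  by (cases P rule: ec_neg.cases) auto

lemma neg_add_self [simp]: "ec_neg P \<oplus> P = None"
  using add_neg[of "ec_neg P"] by simp

lemma add_opposite: "Some (x, y) \<oplus> Some (x, - y) = None"
  using add_neg[of "Some (x, y)"] by simp

lemmas [simp del] = ec_add.simps(3)

lemma add_closed: "P \<in> E \<Longrightarrow> Q \<in> E \<Longrightarrow> P \<oplus> Q \<in> E"
proof -
  assume PQ: "P \<in> E" "Q \<in> E"
  have "Some (x1, y1) \<oplus> Some (x2, y2) \<in> E" if eqs: "P = Some (x1, y1)" "Q = Some (x2, y2)" for x1 y1 x2 y2
  proof (cases "Some (x1, y1) \<oplus> Some (x2, y2)")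
    case None
    then show ?thesis by (simp only: None) (simp add: ec_points_def)
  next
    case (Some S)
    obtain x3 y3 where S: "S = (x3, y3)" by (cases S)
    then have eq: "Some (x1, y1) \<oplus> Some (x2, y2) = Some (x3, y3)" using Some by auto
    obtain l v where L: "line l v x1 y1 x2 y2 x3 (- y3)"
      using add_eq_SomeD[OF _ _ eq] PQ eqs by auto
    have "(- y3) ^ 2 = x3 ^ 3 + a * x3 + b"
      using ec_line_on_curve[OF ec_line_rotate[OF ec_line_rotate[OF L]]] .
    then show ?thesis unfolding eq by (simp add: ec_points_def)
  qed
  then show ?thesis using PQ by (cases P; cases Q) auto
qed

lemma add_comm:
  assumes "P \<in> E" "Q \<in> E"
  shows "P \<oplus> Q = Q \<oplus> P"
proof -
  have "Some (x1, y1) \<oplus> Some (x2, y2) = Some (x2, y2) \<oplus> Some (x1, y1)"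
    if PQ: "P = Some (x1, y1)" "Q = Some (x2, y2)" for x1 y1 x2 y2
  proof (cases "Some (x1, y1) \<oplus> Some (x2, y2)")
    case None
    then show ?thesis using add_eq_NoneD[OF None] add_opposite[of x2 y2] add_opposite[of x1 "- y1"] by simp
  next
    case (Some S)
    obtain x3 y3 where S: "S = (x3, y3)" by (cases S)
    obtain l v where "line l v x1 y1 x2 y2 x3 (- y3)"
      using add_eq_SomeD[of x1 y1 x2 y2 x3 y3] Some assms unfolding PQ S by auto
    then have "Some (x2, y2) \<oplus> Some (x1, y1) = Some (x3, y3)"
      using ec_line_swap add_eq_SomeI by blast
    then show ?thesis using Some S by simp
  qed
  then show ?thesis by (cases P; cases Q) auto
qed

text \<open>The line through \<open>P\<close>, \<open>Q\<close> and the negative of their sum,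
  reordered and reflected in the x-axis, passes through the negative of \<open>P\<close>, the sum
  and the negative of \<open>Q\<close>.\<close>

lemma neg_add_cancel:
  assumes "P \<in> E" "Q \<in> E"
  shows "ec_neg P \<oplus> (P \<oplus> Q) = Q"
proof -
  have "Some (x1, - y1) \<oplus> (Some (x1, y1) \<oplus> Some (x2, y2)) = Some (x2, y2)"
    if PQ: "P = Some (x1, y1)" "Q = Some (x2, y2)" for x1 y1 x2 y2
  proof (cases "Some (x1, y1) \<oplus> Some (x2, y2)")
    case None
    then show ?thesis using add_eq_NoneD[OF None] by simp
  next
    case (Some S)
    obtain x3 y3 where S: "S = (x3, y3)" by (cases S)
    obtain l v where "line l v x1 y1 x2 y2 x3 (- y3)"
      using add_eq_SomeD[of x1 y1 x2 y2 x3 y3] Some assms unfolding PQ S by auto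
    then have "line l v x1 y1 x3 (- y3) x2 y2" using ec_line_swap ec_line_rotate by blast
    then have "line (- l) (- v) x1 (- y1) x3 y3 x2 (- y2)" using ec_line_neg[of a b l v x1 y1 x3 "- y3"] by simp
    then show ?thesis using add_eq_SomeI Some S by simp
  qed
  then show ?thesis by (cases P; cases Q) auto
qed

lemma neg_add:
  assumes "P \<in> E" "Q \<in> E"
  shows "ec_neg (P \<oplus> Q) = ec_neg P \<oplus> ec_neg Q"
proof -
  have "ec_neg (Some (x1, y1) \<oplus> Some (x2, y2)) = Some (x1, - y1) \<oplus> Some (x2, - y2)"
    if PQ: "P = Some (x1, y1)" "Q = Some (x2, y2)" for x1 y1 x2 y2
  proof (cases "Some (x1, y1) \<oplus> Some (x2, y2)")
    case None
    then show ?thesis using add_eq_NoneD[OF None] add_opposite[of x1 "- y1"] by simp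
  next
    case (Some S)
    obtain x3 y3 where S: "S = (x3, y3)" by (cases S)
    obtain l v where "line l v x1 y1 x2 y2 x3 (- y3)"
      using add_eq_SomeD[of x1 y1 x2 y2 x3 y3] Some assms unfolding PQ S by auto
    then show ?thesis using add_eq_SomeI[OF ec_line_neg] Some S by simp
  qed
  then show ?thesis by (cases P; cases Q) auto
qed

section \<open>Associativity of the group law\<close>

text \<open>The quotient of \<open>(y + t - l (x - s)) (y - t - m (x - s))\<close> by \<open>x - s\<close> modulo the equation of the
  curve.\<close>
lemma conic_vanishes:
  assumes "line l v x1 y1 x2 y2 s (- t)"
  shows "x1 ^ 2 - (l + m) * y1 + (s + l * m) * x1 + (s ^ 2 + a + (l - m) * t - l * m * s) = 0"
  using assms unfolding ec_line_def by algebra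

text \<open>The difference of the two functions is a linear form
  \<open>\<alpha> y + \<beta> x + \<gamma>\<close> vanishing at all three points, with multiplicity
  when the first two coincide. If \<open>\<alpha>\<close> were nonzero, the third point would lie on
  the line through the first two and be one of its excluded zeros; \<open>\<alpha> = 0\<close> with
  \<open>\<beta>\<close> nonzero would force equal abscissas.\<close>

lemma assoc_generic:
  assumes L1: "line l v x1 y1 x2 y2 s (- t)" and L2: "line m r s t x3 y3 u (- w)"
    and L1': "line l' v' x2 y2 x3 y3 s' (- t')" and L2': "line m' r' x1 y1 s' t' u' (- w')"
    and RP: "(x3, y3) \<noteq> (x1, y1)" and RQ: "(x3, y3) \<noteq> (x2, y2)" and RnP: "(x3, y3) \<noteq> (x1, - y1)"
  shows "u = u' \<and> w = w'"
proof -
  define A where "A = - (l + m)"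
  define B where "B = s + l * m"
  define C where "C = s ^ 2 + a + (l - m) * t - l * m * s"
  define A' where "A' = - (l' + m')"
  define B' where "B' = s' + l' * m'"
  define C' where "C' = s' ^ 2 + a + (l' - m') * t' - l' * m' * s'"
  \<comment> \<open>Read from the second line, the divided vertical passes through
    \<open>(s, t)\<close> instead of \<open>(s, - t)\<close>. Exchanging \<open>l\<close> with
    \<open>m\<close> and negating \<open>t\<close> gives the same conic.\<close>
  have L2s: "line m r x3 y3 u (- w) s (- (- t))" using ec_line_rotate[OF L2] by simp
  have L2s': "line m' r' u' (- w') x1 y1 s' (- (- t'))" using ec_line_rotate[OF ec_line_rotate[OF L2']] ec_line_rotate L2' by simp
  have g: "x1 ^ 2 + A * y1 + B * x1 + C = 0" "x2 ^ 2 + A * y2 + B * x2 + C = 0"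
      "x3 ^ 2 + A * y3 + B * x3 + C = 0" "u ^ 2 + A * (- w) + B * u + C = 0"
    using conic_vanishes[OF L1, of m] conic_vanishes[OF ec_line_swap[OF L1], of m]
      conic_vanishes[OF L2s, of l] conic_vanishes[OF ec_line_swap[OF L2s], of l]
    unfolding A_def B_def C_def by (simp_all add: algebra_simps)
  have g': "x1 ^ 2 + A' * y1 + B' * x1 + C' = 0" "x2 ^ 2 + A' * y2 + B' * x2 + C' = 0"
      "x3 ^ 2 + A' * y3 + B' * x3 + C' = 0" "u' ^ 2 + A' * (- w') + B' * u' + C' = 0"
    using conic_vanishes[OF L1', of m'] conic_vanishes[OF ec_line_swap[OF L1'], of m']
      conic_vanishes[OF ec_line_swap[OF L2s'], of l'] conic_vanishes[OF L2s', of l']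
    unfolding A'_def B'_def C'_def by (simp_all add: algebra_simps)
  \<comment> \<open>Adds \<open>l^2 = x1 + x2 + s\<close> and
    \<open>m^2 = s + x3 + u\<close>.\<close>
  have u: "u = A ^ 2 - 2 * B - x1 - x2 - x3"
    using L1 L2 unfolding ec_line_def A_def B_def by algebra
  have u': "u' = A' ^ 2 - 2 * B' - x1 - x2 - x3"
    using L1' L2' unfolding ec_line_def A'_def B'_def by algebra
  have cP: "y1 ^ 2 = x1 ^ 3 + a * x1 + b" using ec_line_on_curve[OF L1] .
  have cR: "y3 ^ 2 = x3 ^ 3 + a * x3 + b" using ec_line_on_curve[OF L2s] .
  \<comment> \<open>If \<open>A = 0\<close>, the second line is the mirror image of the first, so
    the third point would be the negative of one of the first two.\<close>
  have A0: "A \<noteq> 0"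
  proof
    assume "A = 0"
    then have m: "m = - l" by (simp add: A_def add_eq_0_iff2)
    have r: "r = - v" using L1 L2 m unfolding ec_line_def by algebra
    have "(x3 - x1) * (x3 - x2) = 0" using L1 L2 unfolding ec_line_def m r by algebra
    then consider "x3 = x1" | "x3 = x2" by auto
    then show False
    proof cases
      case 1
      then have "y3 = - y1" using L1 L2 unfolding ec_line_def m r by simp
      then show False using 1 RnP by simp
    next
      case 2
      then have "y2 = - y3" using L1 L2 unfolding ec_line_def m r by simp
      then show False using 2 not_opposite[OF L1'] by simp
    qed
  qed
  define \<alpha> where "\<alpha> = A - A'"
  define \<beta> where "\<beta> = B - B'"
  define \<gamma> where "\<gamma> = C - C'"
  have h: "\<alpha> * y1 + \<beta> * x1 + \<gamma> = 0" "\<alpha> * y2 + \<beta> * x2 + \<gamma> = 0" "\<alpha> * y3 + \<beta> * x3 + \<gamma> = 0"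
    using g g' unfolding \<alpha>_def \<beta>_def \<gamma>_def by algebra+
  have "\<alpha> = 0"
  proof (rule ccontr)
    assume \<alpha>: "\<alpha> \<noteq> 0"
    have "\<beta> = - \<alpha> * l"
    proof (cases "x1 = x2")
      case False
      have "(x1 - x2) * (\<beta> + \<alpha> * l) = 0" using h L1 unfolding ec_line_def by algebra
      then show ?thesis using False by (simp add: add_eq_0_iff2)
    next
      case True
      then have y: "y1 = y2" using L1 unfolding ec_line_def by simp
      have y0: "2 * y1 \<noteq> 0" using not_opposite[OF L1] True y by (metis add_eq_0_iff mult_2)
      have D: "2 * y1 * l = 3 * x1 ^ 2 + a"
        using ec_line_tangent L1 unfolding True[symmetric] by blast
      \<comment> \<open>Vanishing of the derivative along the curve at the double point, cleared of
        the denominator \<open>2 * y1\<close>.\<close>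
      have t1: "2 * y1 * (2 * x1 + B) + A * (3 * x1 ^ 2 + a) = 0"
        using D L1 True y unfolding ec_line_def A_def B_def by algebra
      \<comment> \<open>The primed function arises by dividing by \<open>x - s'\<close>, so its
        double zero is visible only after this factor is cancelled.\<close>
      have "x1 \<noteq> s'"
      proof
        assume s': "x1 = s'"
        have "t' ^ 2 = s' ^ 3 + a * s' + b"
          using ec_line_on_curve[OF ec_line_swap[OF L2']] .
        then have "(y1 - t') * (y1 + t') = 0" using cP s' by algebra
        then consider "y1 = t'" | "y1 = - t'" by (auto simp: add_eq_0_iff2)
        then show False
        proof cases
          case 1
          have "line l' v' x2 y2 s' (- t') x3 y3" using ec_line_swap[OF ec_line_rotate[OF ec_line_rotate[OF L1']]] .
          from not_opposite[OF this] show False using 1 True y s' by simp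
        next
          case 2
          then show False using not_opposite[OF L2'] s' by simp
        qed
      qed
      \<comment> \<open>The double point lies on both primed lines, one through each of its copies,
        so their product vanishes there twice.\<close>
      moreover have "(x1 - s') * (2 * y1 * (2 * x1 + B') + A' * (3 * x1 ^ 2 + a)) = 0"
      proof -
        have e: "y1 = l' * (x1 - s') - t'" "y1 = m' * (x1 - s') + t'"
          using L1' L2' True y unfolding ec_line_def by algebra+
        have "t' ^ 2 = s' ^ 3 + a * s' + b"
          using ec_line_on_curve[OF ec_line_swap[OF L2']] .
        then have "(x1 - s') * (x1 ^ 2 + x1 * s' + s' ^ 2 + a - l' * m' * (x1 - s')) = 0"
          using cP e by algebra
        then show ?thesis using e unfolding A'_def B'_def by algebra
      qed
      ultimately have t2: "2 * y1 * (2 * x1 + B') + A' * (3 * x1 ^ 2 + a) = 0" by simp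
      have "2 * y1 * (\<beta> + \<alpha> * l) = 0"
        using t1 t2 D unfolding \<alpha>_def \<beta>_def by algebra
      then show ?thesis using y0 by (simp add: add_eq_0_iff2)
    qed
    moreover have "\<alpha> * (y3 - (l * x3 + v)) = 0"
      using h L1 calculation unfolding ec_line_def by algebra
    ultimately have y3: "y3 = l * x3 + v" using \<alpha> by simp
    \<comment> \<open>A curve point on the first line is one of its three intersections with the
      curve.\<close>
    have "(x3 - x1) * (x3 - x2) * (x3 - s) = 0"
      using L1 cR y3 unfolding ec_line_def by algebra
    then consider "x3 = x1" | "x3 = x2" | "x3 = s" by auto
    then show False
    proof cases
      case 1
      then show False using L1 y3 RP by (simp add: ec_line_def)
    next
      case 2
      then show False using L1 y3 RQ by (simp add: ec_line_def)
    next
      case 3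
      then have "- t = y3" using L1 y3 unfolding ec_line_def by simp
      then have "t = - y3" by (metis minus_minus)
      then show False using 3 not_opposite[OF L2] by simp
    qed
  qed
  moreover have "\<beta> = 0"
  proof (rule ccontr)
    assume "\<beta> \<noteq> 0"
    moreover have "\<beta> * (x3 - x1) = 0" using h \<open>\<alpha> = 0\<close> by algebra
    ultimately have x: "x3 = x1" by simp
    have "(y3 - y1) * (y3 + y1) = 0" using cP cR unfolding x by algebra
    then show False using RP RnP x by (auto simp: add_eq_0_iff2)
  qed
  ultimately have eqs: "A' = A" "B' = B" "C' = C"
    using h(1) by (simp_all add: \<alpha>_def \<beta>_def \<gamma>_def)
  then have u_eq: "u' = u" using u u' by simp
  have "A * w' = A * w" using g(4) g'(4) unfolding eqs u_eq by algebra
  then show ?thesis using A0 u_eq by simp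
qed

lemma add_eq_None_iff: "P \<oplus> Q = None \<longleftrightarrow> Q = ec_neg P"
proof
  assume *: "P \<oplus> Q = None"
  show "Q = ec_neg P"
  proof (cases P)
    case None
    then show ?thesis using * by simp
  next
    case (Some p)
    have "Q \<noteq> None"
    proof
      assume "Q = None"
      then show False using * Some by simp
    qed
    then obtain q where "Q = Some q" by (cases Q) simp_all
    then show ?thesis using Some * add_eq_NoneD by (cases p; cases q) auto
  qed
qed simp

lemma add_neg_cancel:
  assumes "P \<in> E" "Q \<in> E"
  shows "P \<oplus> (ec_neg P \<oplus> Q) = Q"
  using neg_add_cancel[OF ec_neg_points[OF assms(1)] assms(2)] by simp

text \<open>The cancellation laws settle every case with a point at infinity among the arguments or
  sums, leaving four genuine lines for \<open>assoc_generic\<close>.\<close>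

lemma assoc_distinct:
  assumes P: "P \<in> E" and Q: "Q \<in> E" and R: "R \<in> E" and "R \<noteq> P" "R \<noteq> Q"
  shows "(P \<oplus> Q) \<oplus> R = P \<oplus> (Q \<oplus> R)"
proof -
  note closed = add_closed[OF P Q] add_closed[OF Q R]
  note neg = ec_neg_points[OF P] ec_neg_points[OF Q] ec_neg_points[OF R]
  consider "P = None \<or> Q = None \<or> R = None" | "Q = ec_neg P" | "R = ec_neg Q" | "R = ec_neg P"
    | "R = ec_neg (P \<oplus> Q)" | "Q \<oplus> R = ec_neg P"
    | "P \<noteq> None" "Q \<noteq> None" "R \<noteq> None" "P \<oplus> Q \<noteq> None" "Q \<oplus> R \<noteq> None"
      "(P \<oplus> Q) \<oplus> R \<noteq> None" "P \<oplus> (Q \<oplus> R) \<noteq> None" "R \<noteq> ec_neg P"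
    unfolding add_eq_None_iff by blast
  then show ?thesis
  proof cases
    case 1
    then show ?thesis by auto
  next
    case 2
    then show ?thesis using add_neg_cancel[OF P R] by simp
  next
    case 3
    have "(P \<oplus> Q) \<oplus> R = ec_neg Q \<oplus> (Q \<oplus> P)"
      using add_comm[OF closed(1) R] add_comm[OF P Q] 3 by simp
    then show ?thesis using neg_add_cancel[OF Q P] 3 by simp
  next
    case 4
    have "(P \<oplus> Q) \<oplus> R = ec_neg P \<oplus> (P \<oplus> Q)" using add_comm[OF closed(1) R] 4 by simp
    moreover have "P \<oplus> (Q \<oplus> R) = P \<oplus> (ec_neg P \<oplus> Q)" using add_comm[OF Q R] 4 by simp
    ultimately show ?thesis using neg_add_cancel[OF P Q] add_neg_cancel[OF P Q] by simp
  next
    case 5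
    have "R = ec_neg Q \<oplus> ec_neg P" using 5 neg_add[OF P Q] add_comm[OF neg(1,2)] by simp
    then have "Q \<oplus> R = ec_neg P" using add_neg_cancel[OF Q neg(1)] by simp
    then show ?thesis using 5 by simp
  next
    case 6
    have "R = ec_neg Q \<oplus> ec_neg P" using 6 neg_add_cancel[OF Q R] by simp
    then have "R = ec_neg (P \<oplus> Q)" using neg_add[OF P Q] add_comm[OF neg(1,2)] by simp
    then show ?thesis using 6 by simp
  next
    case 7
    obtain x1 y1 x2 y2 x3 y3 where pts: "P = Some (x1, y1)" "Q = Some (x2, y2)" "R = Some (x3, y3)"
      using 7(1-3) by auto
    obtain s t s' t' where S: "P \<oplus> Q = Some (s, t)" "Q \<oplus> R = Some (s', t')"
      using 7(4,5) by auto
    obtain u w u' w' where U: "(P \<oplus> Q) \<oplus> R = Some (u, w)" "P \<oplus> (Q \<oplus> R) = Some (u', w')"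
      using 7(6,7) by auto
    obtain l v where L1: "line l v x1 y1 x2 y2 s (- t)"
      using add_eq_SomeD P Q S(1) unfolding pts by blast
    obtain m r where L2: "line m r s t x3 y3 u (- w)"
      using add_eq_SomeD[of s t x3 y3 u w] closed(1) R U(1) unfolding S(1) pts(3) by blast
    obtain l' v' where L1': "line l' v' x2 y2 x3 y3 s' (- t')"
      using add_eq_SomeD Q R S(2) unfolding pts by blast
    obtain m' r' where L2': "line m' r' x1 y1 s' t' u' (- w')"
      using add_eq_SomeD[of x1 y1 s' t' u' w'] closed(2) P U(2) unfolding S(2) pts(1) by blast
    have "u = u' \<and> w = w'"
      by (rule assoc_generic[OF L1 L2 L1' L2']) (use assms(4,5) 7(8) pts in auto)
    then show ?thesis using U by simp
  qed
qed

text \<open>Commutativity exchanges the outer points. It settles \<open>R = P\<close> directly and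
  reduces \<open>R = Q\<close> to the distinct case read backwards.\<close>

lemma add_assoc:
  assumes P: "P \<in> E" and Q: "Q \<in> E" and R: "R \<in> E"
  shows "(P \<oplus> Q) \<oplus> R = P \<oplus> (Q \<oplus> R)"
proof -
  have flip: "(P \<oplus> Q) \<oplus> R = R \<oplus> (Q \<oplus> P)" "P \<oplus> (Q \<oplus> R) = (R \<oplus> Q) \<oplus> P"
    using add_comm[OF add_closed[OF P Q] R] add_comm[OF P Q]
      add_comm[OF P add_closed[OF Q R]] add_comm[OF Q R] by simp_all
  consider "R = P" | "R \<noteq> P" "R \<noteq> Q" | "P \<noteq> R" "P \<noteq> Q" by blast
  then show ?thesis
  proof cases
    case 1
    then show ?thesis using flip by simp
  next
    case 2
    then show ?thesis by (rule assoc_distinct[OF P Q R])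
  next
    case 3
    then show ?thesis using assoc_distinct[OF R Q P] flip by simp
  qed
qed

lemma comm_group_ec: "comm_group (ec_group a b)"
proof (rule comm_groupI)
  fix P assume "P \<in> carrier (ec_group a b)"
  then show "\<exists>Q\<in>carrier (ec_group a b). Q \<otimes>\<^bsub>ec_group a b\<^esub> P = \<one>\<^bsub>ec_group a b\<^esub>"
    by (intro bexI[of _ "ec_neg P"]) (simp_all add: ec_group_def ec_neg_points)
qed (auto simp: ec_group_def add_closed add_assoc intro: add_comm, simp add: ec_points_def)

end

section \<open>Points as triples\<close>

text \<open>The first entry tells affine points from infinity; padding infinity with zeros gives all
  points one length.\<close>

fun ec_tuple :: "('a::field \<times> 'a) option \<Rightarrow> 'a list" where
  "ec_tuple None = [0, 0, 0]"
| "ec_tuple (Some (x, y)) = [1, x, y]"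

definition tuple_ec :: "'a::field list \<Rightarrow> ('a \<times> 'a) option" where
  "tuple_ec v = (if v ! 0 = 0 then None else Some (v ! 1, v ! 2))"

lemma tuple_ec_tuple [simp]: "tuple_ec (ec_tuple P) = P"
  by (cases P rule: ec_tuple.cases) (auto simp: tuple_ec_def)

lemma length_ec_tuple [simp]: "length (ec_tuple P) = 3"
  by (cases P rule: ec_tuple.cases) auto

lemma inj_ec_tuple: "inj ec_tuple"
  by (rule inj_on_inverseI[of _ tuple_ec]) simp

lemma definableI:
  assumes "codef P P" and "\<And>v. length v = n \<Longrightarrow> P (env v e) \<longleftrightarrow> v \<in> S" and "\<And>v. v \<in> S \<Longrightarrow> length v = n"
  shows "definable n S"
  using assms(1)
proof (rule codefE)
  fix \<phi> assume \<phi>: "\<And>e. rsat e \<phi> = P e"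
  have "S = {v. length v = n \<and> rsat (env v e) \<phi>}"
    using assms(2,3) unfolding \<phi> by blast
  then show ?thesis unfolding definable_def by blast
qed

definition ec_tuple_eqn :: "'a::field \<Rightarrow> 'a \<Rightarrow> 'a \<Rightarrow> 'a \<Rightarrow> 'a \<Rightarrow> bool" where
  "ec_tuple_eqn a b p x y \<longleftrightarrow> p = 0 \<and> x = 0 \<and> y = 0 \<or> p = 1 \<and> y ^ 2 = x ^ 3 + a * x + b"

lemma ec_tuple_in_image: "[p, x, y] \<in> ec_tuple ` ec_points a b \<longleftrightarrow> ec_tuple_eqn a b p x y"
  by (force simp: ec_points_def image_iff ec_tuple_eqn_def)

lemma length_3_cases:
  assumes "length v = 3"
  obtains p x y where "v = [p, x, y]"
  using assms by (auto simp: numeral_3_eq_3 length_Suc_conv)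

lemma definable_ec_points: "definable 3 (ec_tuple ` ec_points a b)"
\<comment> \<open>The triple occupies indices 0 to 2; the curve coefficients are parameters at 3 and
  4.\<close>
proof (rule definableI[where e = "\<lambda>i. if i = 3 then a else b" and
      P = "\<lambda>e. ec_tuple_eqn (e 3) (e 4) (e 0) (e 1) (e 2)"])
  show "codef (\<lambda>e. ec_tuple_eqn (e 3) (e 4) (e 0) (e 1) (e 2 :: 'a))
      (\<lambda>e. ec_tuple_eqn (e 3) (e 4) (e 0) (e 1) (e 2 :: 'a))"
    unfolding ec_tuple_eqn_def by (intro codef_intros)
next
  fix v :: "'a list" assume "length v = 3"
  then obtain p x y where v: "v = [p, x, y]" by (rule length_3_cases)
  show "ec_tuple_eqn (env v (\<lambda>i. if i = 3 then a else b) 3) (env v (\<lambda>i. if i = 3 then a else b) 4)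
      (env v (\<lambda>i. if i = 3 then a else b) 0) (env v (\<lambda>i. if i = 3 then a else b) 1)
      (env v (\<lambda>i. if i = 3 then a else b) 2) \<longleftrightarrow> v \<in> ec_tuple ` ec_points a b"
    unfolding v ec_tuple_in_image by (simp add: env_def)
qed auto

lemma comm_group_inj_image:
  assumes "comm_group M" "inj h"
  shows "comm_group \<lparr>carrier = h ` carrier M, mult = \<lambda>x y. h (inv_into UNIV h x \<otimes>\<^bsub>M\<^esub> inv_into UNIV h y), one = h \<one>\<^bsub>M\<^esub>\<rparr>"
    (is "comm_group ?H")
proof -
  interpret comm_group M by fact
  have [simp]: "inv_into UNIV h (h x) = x" for x using assms(2) by simp
  show ?thesis
  proof (rule comm_groupI)
    fix x assume "x \<in> carrier ?H"
    then obtain a where a: "a \<in> carrier M" "x = h a" by auto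
    then show "\<exists>y\<in>carrier ?H. y \<otimes>\<^bsub>?H\<^esub> x = \<one>\<^bsub>?H\<^esub>"
      by (intro bexI[of _ "h (inv\<^bsub>M\<^esub> a)"]) auto
  qed (auto simp: m_assoc intro!: arg_cong[of _ _ h] m_comm)
qed

text \<open>Transport of structure: scalars act through \<open>h\<close> and its inverse, and
  \<open>h\<close> preserves integer powers as a homomorphism.\<close>

lemma starZ_module_ext_inj_image:
  assumes M: "comm_group M" and h: "inj h"
    and sm: "starZ_module_ext \<lparr>carrier = h ` carrier M,
      mult = \<lambda>x y. h (inv_into UNIV h x \<otimes>\<^bsub>M\<^esub> inv_into UNIV h y), one = h \<one>\<^bsub>M\<^esub>\<rparr> Z sm"
      (is "starZ_module_ext ?H Z sm")
  shows "\<exists>sm. starZ_module_ext M Z sm"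
proof -
  interpret M: comm_group M by fact
  interpret H: comm_group ?H using comm_group_inj_image[OF M h] .
  define k where "k = inv_into UNIV h"
  have k [simp]: "k (h x) = x" for x using h by (simp add: k_def)
  have hk: "h (k x) = x" if "x \<in> h ` carrier M" for x using that by auto
  have hom: "group_hom M ?H h"
    by (unfold_locales) (use k in \<open>auto simp: hom_def k_def[symmetric]\<close>)
  have pow: "h (x [^]\<^bsub>M\<^esub> n) = h x [^]\<^bsub>?H\<^esub> n" if "x \<in> carrier M" for x and n :: int
    using group_hom.hom_int_pow[OF hom that] .
  note s = sm[unfolded starZ_module_ext_def]
  note s1 = s[THEN conjunct1]
  note t1 = s[THEN conjunct2]
  note s2 = t1[THEN conjunct1]
  note t2 = t1[THEN conjunct2]
  note s3 = t2[THEN conjunct1]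
  note t3 = t2[THEN conjunct2]
  note s4 = t3[THEN conjunct1]
  note t4 = t3[THEN conjunct2]
  note s5 = t4[THEN conjunct1]
  note s6 = t4[THEN conjunct2]
  have c: "sm r (h x) \<in> h ` carrier M" if "r \<in> Z" "x \<in> carrier M" for r x
    using s1 that by simp
  have "starZ_module_ext M Z (\<lambda>r x. k (sm r (h x)))"
    unfolding starZ_module_ext_def
  proof (intro conjI ballI allI)
    fix r x assume r: "r \<in> Z" "x \<in> carrier M"
    show "k (sm r (h x)) \<in> carrier M" using c[OF r] by auto
  next
    fix r s x assume r: "r \<in> Z" "s \<in> Z" "x \<in> carrier M"
    have "sm (r + s) (h x) = h (k (sm r (h x)) \<otimes>\<^bsub>M\<^esub> k (sm s (h x)))"
      using s2 r by (simp add: k_def)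
    then show "k (sm (r + s) (h x)) = k (sm r (h x)) \<otimes>\<^bsub>M\<^esub> k (sm s (h x))" by simp
    have "sm (r * s) (h x) = sm r (sm s (h x))" using s4 r by simp
    then show "k (sm (r * s) (h x)) = k (sm r (h (k (sm s (h x)))))"
      using hk[OF c[OF r(2,3)]] by simp
  next
    fix r x y assume r: "r \<in> Z" "x \<in> carrier M" "y \<in> carrier M"
    have "sm r (h (k (h x) \<otimes>\<^bsub>M\<^esub> k (h y))) = h (k (sm r (h x)) \<otimes>\<^bsub>M\<^esub> k (sm r (h y)))"
      using s3 r unfolding k_def by simp
    then show "k (sm r (h (x \<otimes>\<^bsub>M\<^esub> y))) = k (sm r (h x)) \<otimes>\<^bsub>M\<^esub> k (sm r (h y))" by simp
  next
    fix x assume x: "x \<in> carrier M"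
    show "k (sm 1 (h x)) = x" using s5 x by simp
  next
    fix n :: int and x assume x: "x \<in> carrier M"
    have "sm (of_int n) (h x) = h (x [^]\<^bsub>M\<^esub> n)" using s6 x pow by simp
    then show "k (sm (of_int n) (h x)) = x [^]\<^bsub>M\<^esub> n" by simp
  qed
  then show ?thesis by blast
qed

section \<open>Definability of the addition of points\<close>

context elliptic begin

abbreviation tuple_group where
  "tuple_group \<equiv> \<lparr>carrier = ec_tuple ` carrier (ec_group a b),
      mult = \<lambda>x y. ec_tuple (inv_into UNIV ec_tuple x \<otimes>\<^bsub>ec_group a b\<^esub> inv_into UNIV ec_tuple y),
      one = ec_tuple \<one>\<^bsub>ec_group a b\<^esub>\<rparr>"

text \<open>Quantifying over the slope and intercept of the line avoids division, which ring terms
  cannot express.\<close>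

definition sum_eqn where
  "sum_eqn A B p1 x1 y1 p2 x2 y2 p3 x3 y3 \<longleftrightarrow>
    ec_tuple_eqn A B p1 x1 y1 \<and> ec_tuple_eqn A B p2 x2 y2 \<and>
    (p1 = 0 \<and> p3 = p2 \<and> x3 = x2 \<and> y3 = y2 \<or>
     p1 = 1 \<and> p2 = 0 \<and> p3 = 1 \<and> x3 = x1 \<and> y3 = y1 \<or>
     p1 = 1 \<and> p2 = 1 \<and>
      (x1 = x2 \<and> y1 = - y2 \<and> p3 = 0 \<and> x3 = 0 \<and> y3 = 0 \<or>
       p3 = 1 \<and> (\<exists>l v. ec_line A B l v x1 y1 x2 y2 x3 (- y3))))"

lemma tuple_sum_iff:
  assumes "[p1, x1, y1] \<in> ec_tuple ` E" "[p2, x2, y2] \<in> ec_tuple ` E"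
  shows "[p3, x3, y3] = ec_tuple (tuple_ec [p1, x1, y1] \<oplus> tuple_ec [p2, x2, y2]) \<longleftrightarrow>
    p1 = 0 \<and> p3 = p2 \<and> x3 = x2 \<and> y3 = y2 \<or>
    p1 = 1 \<and> p2 = 0 \<and> p3 = 1 \<and> x3 = x1 \<and> y3 = y1 \<or>
    p1 = 1 \<and> p2 = 1 \<and>
      (x1 = x2 \<and> y1 = - y2 \<and> p3 = 0 \<and> x3 = 0 \<and> y3 = 0 \<or>
       p3 = 1 \<and> (\<exists>l v. line l v x1 y1 x2 y2 x3 (- y3)))"
proof -
  consider "p1 = 0" | "p1 = 1" "p2 = 0" | "p1 = 1" "p2 = 1"
    using assms unfolding ec_tuple_in_image ec_tuple_eqn_def by blast
  then show ?thesis
  proof cases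
    case 1
    then show ?thesis using assms unfolding ec_tuple_in_image ec_tuple_eqn_def by (auto simp: tuple_ec_def)
  next
    case 2
    then show ?thesis using assms unfolding ec_tuple_in_image ec_tuple_eqn_def by (auto simp: tuple_ec_def)
  next
    case 3
    then have pts: "Some (x1, y1) \<in> E" "Some (x2, y2) \<in> E"
      using assms unfolding ec_tuple_in_image ec_tuple_eqn_def by (auto simp: ec_points_def)
    have eq: "tuple_ec [p1, x1, y1] \<oplus> tuple_ec [p2, x2, y2] = Some (x1, y1) \<oplus> Some (x2, y2)"
      using 3 by (simp add: tuple_ec_def)
    show ?thesis
    proof (cases "Some (x1, y1) \<oplus> Some (x2, y2)")
      case None
      then have "x1 = x2 \<and> y1 = - y2" using add_eq_NoneD[OF None] by simp
      \<comment> \<open>No non-vertical line joins opposite points, so the affine disjunct is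
        excluded when the sum is infinity.\<close>
      moreover from this have "\<not> (\<exists>l v. line l v x1 y1 x2 y2 x3 (- y3))"
        using not_opposite by blast
      ultimately show ?thesis using 3 unfolding eq None by auto
    next
      case (Some S)
      obtain x y where S: "S = (x, y)" by (cases S)
      have "\<not> (x1 = x2 \<and> y1 = - y2)" using Some by (auto simp: ec_add.simps(3))
      moreover have "(\<exists>l v. line l v x1 y1 x2 y2 x3 (- y3)) \<longleftrightarrow> x3 = x \<and> y3 = y"
      proof
        assume "\<exists>l v. line l v x1 y1 x2 y2 x3 (- y3)"
        then have "Some (x1, y1) \<oplus> Some (x2, y2) = Some (x3, y3)" using add_eq_SomeI by blast
        then show "x3 = x \<and> y3 = y" using Some S by simp
      next
        assume "x3 = x \<and> y3 = y"
        then show "\<exists>l v. line l v x1 y1 x2 y2 x3 (- y3)" using add_eq_SomeD[OF pts] Some S by simp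
      qed
      ultimately show ?thesis using 3 unfolding eq Some S by auto
    qed
  qed
qed

lemma length_9_cases:
  assumes "length v = 9"
  obtains p1 x1 y1 p2 x2 y2 p3 x3 y3 where "v = [p1, x1, y1] @ [p2, x2, y2] @ [p3, x3, y3]"
  using assms by (auto simp: eval_nat_numeral length_Suc_conv)

lemma tuple_graph_iff:
  "[p1, x1, y1] @ [p2, x2, y2] @ [p3, x3, y3] \<in>
      {v @ w @ mult tuple_group v w | v w. v \<in> carrier tuple_group \<and> w \<in> carrier tuple_group} \<longleftrightarrow>
    [p1, x1, y1] \<in> ec_tuple ` E \<and> [p2, x2, y2] \<in> ec_tuple ` E \<and>
    [p3, x3, y3] = ec_tuple (tuple_ec [p1, x1, y1] \<oplus> tuple_ec [p2, x2, y2])"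
proof -
  have inv: "inv_into UNIV ec_tuple v = tuple_ec v" if "v \<in> range ec_tuple" for v :: "'a list"
    using that by (auto simp: inv_f_f[OF inj_ec_tuple])
  have car: "carrier tuple_group = ec_tuple ` E" by (simp add: ec_group_def)
  have mult: "mult tuple_group v w = ec_tuple (tuple_ec v \<oplus> tuple_ec w)"
    if "v \<in> ec_tuple ` E" "w \<in> ec_tuple ` E" for v w
  proof -
    have "v \<in> range ec_tuple" "w \<in> range ec_tuple" using that by blast+
    then show ?thesis using inv by (simp add: ec_group_def)
  qed
  show ?thesis
  proof
    assume "[p1, x1, y1] @ [p2, x2, y2] @ [p3, x3, y3] \<in>
      {v @ w @ mult tuple_group v w | v w. v \<in> carrier tuple_group \<and> w \<in> carrier tuple_group}"
    then obtain v w where vw: "v \<in> ec_tuple ` E" "w \<in> ec_tuple ` E"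
        and eq: "[p1, x1, y1] @ [p2, x2, y2] @ [p3, x3, y3] = v @ w @ mult tuple_group v w"
      unfolding car by blast
    have "length v = 3" "length w = 3" using vw by auto
    then have "v = [p1, x1, y1]" "w = [p2, x2, y2]" "[p3, x3, y3] = mult tuple_group v w"
      using eq by (auto simp: append_eq_append_conv simp del: append.simps)
    then show "[p1, x1, y1] \<in> ec_tuple ` E \<and> [p2, x2, y2] \<in> ec_tuple ` E \<and>
        [p3, x3, y3] = ec_tuple (tuple_ec [p1, x1, y1] \<oplus> tuple_ec [p2, x2, y2])"
      using vw mult[OF vw] by simp
  next
    assume *: "[p1, x1, y1] \<in> ec_tuple ` E \<and> [p2, x2, y2] \<in> ec_tuple ` E \<and>
        [p3, x3, y3] = ec_tuple (tuple_ec [p1, x1, y1] \<oplus> tuple_ec [p2, x2, y2])"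
    then have "[p3, x3, y3] = mult tuple_group [p1, x1, y1] [p2, x2, y2]" using mult by metis
    then show "[p1, x1, y1] @ [p2, x2, y2] @ [p3, x3, y3] \<in>
      {v @ w @ mult tuple_group v w | v w. v \<in> carrier tuple_group \<and> w \<in> carrier tuple_group}"
      using * unfolding car by blast
  qed
qed

lemma definable_tuple_graph:
  "definable 9 {v @ w @ mult tuple_group v w | v w. v \<in> carrier tuple_group \<and> w \<in> carrier tuple_group}"
    (is "definable 9 ?S")
proof (rule definableI[where e = "\<lambda>i. if i = 9 then a else b" and
      P = "\<lambda>e. sum_eqn (e 9) (e 10) (e 0) (e 1) (e 2) (e 3) (e 4) (e 5) (e 6) (e 7) (e 8)"])
  show "codef (\<lambda>e. sum_eqn (e 9) (e 10) (e 0) (e 1) (e 2) (e 3) (e 4) (e 5) (e 6) (e 7) (e 8 :: 'a))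
      (\<lambda>e. sum_eqn (e 9) (e 10) (e 0) (e 1) (e 2) (e 3) (e 4) (e 5) (e 6) (e 7) (e 8 :: 'a))"
    unfolding sum_eqn_def ec_tuple_eqn_def ec_line_def by (intro codef_intros)
next
  fix v :: "'a list" assume "length v = 9"
  then obtain p1 x1 y1 p2 x2 y2 p3 x3 y3 where v: "v = [p1, x1, y1] @ [p2, x2, y2] @ [p3, x3, y3]"
    by (rule length_9_cases)
  define e where "e = env v (\<lambda>i. if i = 9 then a else b)"
  have e: "e 0 = p1" "e 1 = x1" "e 2 = y1" "e 3 = p2" "e 4 = x2" "e 5 = y2" "e 6 = p3" "e 7 = x3" "e 8 = y3"
      "e 9 = a" "e 10 = b"
    by (simp_all add: e_def v env_def)
  show "sum_eqn (e 9) (e 10) (e 0) (e 1) (e 2) (e 3) (e 4) (e 5) (e 6) (e 7) (e 8) \<longleftrightarrow> v \<in> ?S"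
    unfolding e v tuple_graph_iff
    using tuple_sum_iff[of p1 x1 y1 p2 x2 y2 p3 x3 y3]
    unfolding sum_eqn_def ec_tuple_in_image by blast
qed (auto simp: inv_into_f_f)

end

section \<open>Module structures on definable groups and elliptic curves\<close>

theorem theorem5p1:
  fixes T :: "'a::field itself"
  assumes "inaccessible (UNIV :: 'a set)"
    and "ThQ_model T"
    and "saturated T"
  shows "(\<forall>(n::nat) (A :: 'a list set) f u. definable_group n A f u \<longrightarrow>
            (\<exists>sm. starZ_module_ext \<lparr>carrier = A, mult = f, one = u\<rparr> (starZ T) sm))
       \<and> (\<forall>a b :: 'a. 4 * a ^ 3 + 27 * b ^ 2 \<noteq> 0 \<longrightarrow>
            (\<exists>sm. starZ_module_ext (ec_group a b) (starZ T) sm))"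
proof (intro conjI allI impI)
  fix n and A :: "'a list set" and f u
  assume "definable_group n A f u"
  then show "\<exists>sm. starZ_module_ext \<lparr>carrier = A, mult = f, one = u\<rparr> (starZ T) sm"
    by (rule definable_group_starZ_module[OF assms(2)])
next
  fix a b :: 'a
  assume disc: "4 * a ^ 3 + 27 * b ^ 2 \<noteq> 0"
  have "inj (of_int :: int \<Rightarrow> 'a)"
    using assms(2) unfolding ThQ_model_def by (intro of_int_inj_of_ThQ) (simp add: ThQ_model_def)
  \<comment> \<open>Characteristic other than two, as the chord and tangent law requires.\<close>
  then have "of_int 2 \<noteq> (of_int 0 :: 'a)" by (simp only: inj_eq)
  then interpret elliptic a b using disc by unfold_locales auto
  have "definable_group 3 (carrier tuple_group) (mult tuple_group) (one tuple_group)"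
    unfolding definable_group_def
    using definable_ec_points[of a b] definable_tuple_graph comm_group_inj_image[OF comm_group_ec inj_ec_tuple]
    by (auto simp: ec_group_def)
  from definable_group_starZ_module[OF assms(2) this]
  show "\<exists>sm. starZ_module_ext (ec_group a b) (starZ T) sm"
    using starZ_module_ext_inj_image[OF comm_group_ec inj_ec_tuple] by auto
qed

end
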